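(* Let $\alpha\in\mathbb{R}$, $\alpha\neq-1$, and let $(V,B)\in C^1_sC^2_y(\mathbb{R}^{3+1})\times C^1(\mathbb{R}^{3+1})$, with $V=V(y,s)=(V_1,V_2,V_3)$ and $B=B(y,s)=(B_1,B_2,B_3)$, be a time periodic solution, with period $S_0>0$, of the self-similar inviscid magnetohydrodynamic system on $\mathbb{R}^3\times\mathbb{R}$ $$\frac{\partial V}{\partial s}+\frac{\alpha}{\alpha+1}V+\frac{1}{\alpha+1}(y\cdot\nabla)V+(V\cdot\nabla)V=(B\cdot\nabla)B-\nabla\Big(P+\tfrac12|B|^2\Big),$$ $$\frac{\partial B}{\partial s}+\frac{\alpha}{\alpha+1}B+\frac{1}{\alpha+1}(y\cdot\nabla)B+(V\cdot\nabla)B=(B\cdot\nabla)V,$$ $$\operatorname{div}V=0,\qquad\operatorname{div}B=0.$$ Assume the following, depending on $\alpha$: (i) If $\alpha>0$: there exists an open set $G\subset\mathbb{R}^3$ containing the origin such that $V=0$ on $G\times(0,S_0)$. (ii) If $-1<\alpha\leq0$ or $\alpha<-1$: there exists an open set $G\subset\mathbb{R}^3$ containing the origin such that $V=B=0$ on $G\times(0,S_0)$. Then $V=B=0$ on $\mathbb{R}^{3+1}$.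
   Context: Points of $\mathbb{R}^{3+1}=\mathbb{R}^3\times\mathbb{R}$ are written $(y,s)$; $\nabla$ and $\operatorname{div}$ are taken with respect to $y$. $P=P(y,s)$ is a scalar pressure; the initial values $V(\cdot,0)=V_0$, $B(\cdot,0)=B_0$ are not otherwise prescribed. $(V,B)$ is a time periodic solution with period $S_0$ if, with its pressure $P$, it satisfies the system and $V$, $B$, $P$ are all periodic in $s$ with period $S_0$, i.e. $V(y,s)=V(y,s+S_0)$, $B(y,s)=B(y,s+S_0)$, $P(y,s)=P(y,s+S_0)$ for all $(y,s)\in\mathbb{R}^{3+1}$. $V\in C^1_sC^2_y(\mathbb{R}^{3+1})$ means that $V$ is $C^1$ in $s$ and $C^2$ in $y$: $V$ and $\partial_sV$ have continuous spatial derivatives up to order two. No boundedness or decay as $|y|\to\infty$ is assumed. *)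

theory Defs
  imports "HOL-Analysis.Analysis"
begin

text \<open>Fields live on space-time; a point is a pair \<open>(y, s)\<close> of position and time.\<close>

type_synonym spacetime = "(real^3) \<times> real"

definition dy :: "3 \<Rightarrow> (spacetime \<Rightarrow> 'a::real_normed_vector) \<Rightarrow> spacetime \<Rightarrow> 'a" where
  "dy j f = (\<lambda>(y, s). frechet_derivative (\<lambda>x. f (x, s)) (at y) (axis j 1))"

definition ds :: "(spacetime \<Rightarrow> 'a::real_normed_vector) \<Rightarrow> spacetime \<Rightarrow> 'a" where
  "ds f = (\<lambda>(y, s). vector_derivative (\<lambda>t. f (y, t)) (at s))"

definition diff_y :: "(spacetime \<Rightarrow> 'a::real_normed_vector) \<Rightarrow> bool" where
  "diff_y f \<longleftrightarrow> (\<forall>y s. (\<lambda>x. f (x, s)) differentiable (at y))"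

definition diff_s :: "(spacetime \<Rightarrow> 'a::real_normed_vector) \<Rightarrow> bool" where
  "diff_s f \<longleftrightarrow> (\<forall>y s. (\<lambda>t. f (y, t)) differentiable (at s))"

text \<open>Spatial derivatives up to order \<open>k\<close> exist and are jointly continuous in \<open>(y, s)\<close>.\<close>

primrec Cy :: "nat \<Rightarrow> (spacetime \<Rightarrow> 'a::real_normed_vector) \<Rightarrow> bool" where
  "Cy 0 f \<longleftrightarrow> continuous_on UNIV f"
| "Cy (Suc k) f \<longleftrightarrow> continuous_on UNIV f \<and> diff_y f \<and> (\<forall>j. Cy k (dy j f))"

definition C1s_C2y :: "(spacetime \<Rightarrow> 'a::real_normed_vector) \<Rightarrow> bool" where
  "C1s_C2y f \<longleftrightarrow> diff_s f \<and> Cy 2 f \<and> Cy 2 (ds f)"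

definition C1 :: "('a::real_normed_vector \<Rightarrow> 'b::real_normed_vector) \<Rightarrow> bool" where
  "C1 f \<longleftrightarrow> (\<exists>D :: 'a \<Rightarrow> 'a \<Rightarrow>\<^sub>L 'b.
     continuous_on UNIV D \<and> (\<forall>z. (f has_derivative blinfun_apply (D z)) (at z)))"

text \<open>\<open>conv U F\<close> is \<open>(U \<cdot> \<nabla>) F\<close>; in particular \<open>conv fst F\<close> is \<open>(y \<cdot> \<nabla>) F\<close>.\<close>

definition conv :: "(spacetime \<Rightarrow> real^3) \<Rightarrow> (spacetime \<Rightarrow> real^3) \<Rightarrow> spacetime \<Rightarrow> real^3" where
  "conv U F z = (\<Sum>j\<in>UNIV. (U z $ j) *\<^sub>R dy j F z)"

definition grad_y :: "(spacetime \<Rightarrow> real) \<Rightarrow> spacetime \<Rightarrow> real^3" where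
  "grad_y p z = (\<chi> j. dy j p z)"

definition div_y :: "(spacetime \<Rightarrow> real^3) \<Rightarrow> spacetime \<Rightarrow> real" where
  "div_y F z = (\<Sum>j\<in>UNIV. dy j F z $ j)"

text \<open>
  Since \<open>dy\<close> and \<open>ds\<close> are total, differentiability has to be required separately wherever a
  derivative occurs. For \<open>P\<close> this is part of the definition below; no further regularity of
  \<open>P\<close> is imposed.
\<close>

definition self_similar_MHD ::
  "real \<Rightarrow> (spacetime \<Rightarrow> real^3) \<Rightarrow> (spacetime \<Rightarrow> real^3) \<Rightarrow> (spacetime \<Rightarrow> real) \<Rightarrow> bool" where
  "self_similar_MHD \<alpha> V B P \<longleftrightarrow>
     diff_y V \<and> diff_s V \<and> diff_y B \<and> diff_s B \<and> diff_y P \<and>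
     (\<forall>z.
       ds V z + (\<alpha> / (\<alpha> + 1)) *\<^sub>R V z + (1 / (\<alpha> + 1)) *\<^sub>R conv fst V z + conv V V z
         = conv B B z - grad_y (\<lambda>w. P w + (1/2) * (norm (B w))\<^sup>2) z \<and>
       ds B z + (\<alpha> / (\<alpha> + 1)) *\<^sub>R B z + (1 / (\<alpha> + 1)) *\<^sub>R conv fst B z + conv V B z
         = conv B V z \<and>
       div_y V z = 0 \<and> div_y B z = 0)"

definition time_periodic :: "real \<Rightarrow> (spacetime \<Rightarrow> 'a) \<Rightarrow> bool" where
  "time_periodic S f \<longleftrightarrow> (\<forall>y s. f (y, s) = f (y, s + S))"

text \<open>The pressure belongs to the solution, but the solution is referred to as the pair \<open>(V, B)\<close>.\<close>

definition time_periodic_solution ::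
  "real \<Rightarrow> real \<Rightarrow> (spacetime \<Rightarrow> real^3) \<Rightarrow> (spacetime \<Rightarrow> real^3) \<Rightarrow> bool" where
  "time_periodic_solution \<alpha> S V B \<longleftrightarrow>
     (\<exists>P. self_similar_MHD \<alpha> V B P \<and>
          time_periodic S V \<and> time_periodic S B \<and> time_periodic S P)"

end

theory Submission
  imports Defs
begin

text \<open>
  Let \<open>b = y / (\<alpha> + 1) + V\<close>. Suppose that \<open>V = B = 0\<close> on \<open>{|y| \<le> R}\<close> for all times. Near the sphere
  \<open>|y| = R\<close> the field \<open>V\<close> is small, so \<open>b\<close> (or \<open>-b\<close> if \<open>\<alpha> < -1\<close>) points strictly outwards on a slightly
  larger ball. There \<open>B\<close> solves a linear transport equation along \<open>b\<close>, and a weighted maximum principle,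
  with compactness in time supplied by periodicity, gives \<open>B = 0\<close>. The vorticity then solves a linear
  transport equation too and vanishes as well. Hence \<open>V\<close> is harmonic in \<open>y\<close> on the larger ball and
  zero on the smaller one, so \<open>V = 0\<close> by unique continuation, and the radius \<open>R\<close> can be increased
  indefinitely.

  Unique continuation comes from the monotonicity of Almgren's frequency function. Its solid version
  \<open>A r = \<integral> (1 - |y|\<^sup>2)\<^sub>+ u(r y)\<^sup>2 dy\<close> is used here: the weight is radial, so all integrations by parts go
  through \<open>\<nabla> (- (1 - |y|\<^sup>2)\<^sub>+\<^sup>2 / 4) = (1 - |y|\<^sup>2)\<^sub>+ y\<close>, and no surface integrals occur.
\<close>

section \<open>Unique continuation for harmonic functions\<close>

lemma has_field_derivative_pos_part_square:
  "((\<lambda>t::real. (max 0 t)\<^sup>2) has_field_derivative 2 * max 0 t) (at t)"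
proof -
  consider "t > 0" | "t < 0" | "t = 0" by linarith
  then show ?thesis
  proof cases
    case 1
    have "((\<lambda>t::real. t\<^sup>2) has_field_derivative 2 * max 0 t) (at t)"
      using 1 by (auto intro!: derivative_eq_intros)
    then show ?thesis
      by (rule has_field_derivative_transform_within_open[where S = "{0<..}"]) (use 1 in auto)
  next
    case 2
    have "((\<lambda>t::real. 0) has_field_derivative 2 * max 0 t) (at t)"
      using 2 by (auto intro!: derivative_eq_intros)
    then show ?thesis
      by (rule has_field_derivative_transform_within_open[where S = "{..<0}"]) (use 2 in auto)
  next
    case 3
    have "(\<lambda>h::real. max 0 h) \<midarrow>0\<rightarrow> max 0 0"
      by (intro tendsto_intros)
    \<comment> \<open>This is the difference quotient at 0. The identity covers \<open>h = 0\<close>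
      as well, since division by zero yields 0.\<close>
    moreover have "(max 0 h)\<^sup>2 / h = max 0 h" for h :: real
      by (auto simp: max_def power2_eq_square)
    ultimately show ?thesis
      using 3 by (simp add: DERIV_def)
  qed
qed

text \<open>For \<open>t\<close> in \<open>{-1<..<1}\<close> the box \<open>[-2, 2]^n\<close>
  shifted by \<open>t *\<^sub>R e\<close> still contains the unit ball, so the integral of
  \<open>G (x + t *\<^sub>R e)\<close> over the box does not depend on \<open>t\<close>.
  Differentiating under the integral at \<open>t = 0\<close> gives the claim.\<close>

lemma integral_directional_derivative_eq_0:
  fixes G :: "'a::euclidean_space \<Rightarrow> real"
  assumes der: "\<And>x. (G has_derivative G' x) (at x)"
    and cont: "continuous_on UNIV (\<lambda>x. G' x e)"
    and supp: "\<And>x. norm x \<ge> 1 \<Longrightarrow> G x = 0"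
    and e: "e \<in> Basis"
  shows "integral (cbox (-2 *\<^sub>R One) (2 *\<^sub>R One)) (\<lambda>x. G' x e) = 0"
proof -
  let ?Q = "cbox (-2 *\<^sub>R One) (2 *\<^sub>R One) :: 'a set"
  have contG: "continuous_on UNIV G"
    by (meson der has_derivative_continuous continuous_at_imp_continuous_on)
  have unit: "x \<in> cbox (-1 *\<^sub>R One) (1 *\<^sub>R One)" if "norm x < 1" for x :: 'a
  proof -
    have "\<bar>x \<bullet> b\<bar> \<le> 1" if "b \<in> Basis" for b
      using Basis_le_norm[OF that, of x] \<open>norm x < 1\<close> by linarith
    then show ?thesis
      by (fastforce simp: mem_box abs_le_iff)
  qed
  have total: "integral (cbox a b) G = integral UNIV G"
    if "cbox (-1 *\<^sub>R One) (1 *\<^sub>R One) \<subseteq> cbox a b" for a b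
  proof -
    have "(G has_integral integral (cbox a b) G) (cbox a b)"
      using contG by (intro integrable_integral integrable_continuous) (auto intro: continuous_on_subset)
    moreover have "G x = 0" if "x \<notin> cbox a b" for x
      using supp[of x] unit[of x] that \<open>_ \<subseteq> cbox a b\<close> by force
    ultimately have "(G has_integral integral (cbox a b) G) UNIV"
      by (rule has_integral_on_superset) auto
    then show ?thesis by (simp add: integral_unique)
  qed
  have shifted: "integral ?Q (\<lambda>x. G (x + t *\<^sub>R e)) = integral UNIV G" if "t \<in> {-1<..<1}" for t
  proof -
    have "integral ?Q (\<lambda>x. G (x + t *\<^sub>R e))
        = integral (cbox (-2 *\<^sub>R One + t *\<^sub>R e) (2 *\<^sub>R One + t *\<^sub>R e)) G"
      using integral_shift_cbox[of "-2 *\<^sub>R One + t *\<^sub>R e" "t *\<^sub>R e" "2 *\<^sub>R One + t *\<^sub>R e" G] by simp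
    also have "\<dots> = integral UNIV G"
    proof (rule total, rule subset_box_imp, intro ballI)
      fix i :: 'a assume i: "i \<in> Basis"
      then have "\<bar>(t *\<^sub>R e) \<bullet> i\<bar> \<le> 1"
        using that e by (auto simp: inner_Basis)
      then show "(- 2 *\<^sub>R One + t *\<^sub>R e) \<bullet> i \<le> (- 1 *\<^sub>R One) \<bullet> i \<and>
         (1 *\<^sub>R One) \<bullet> i \<le> (2 *\<^sub>R One + t *\<^sub>R e) \<bullet> i"
        using i by (auto simp: inner_add_left inner_diff_left abs_le_iff)
    qed
    finally show ?thesis .
  qed
  have "((\<lambda>t. integral ?Q (\<lambda>x. G (x + t *\<^sub>R e))) has_field_derivative
      integral ?Q (\<lambda>x. G' (x + 0 *\<^sub>R e) e)) (at 0 within {-1<..<1})"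
  proof (rule leibniz_rule_field_derivative)
    fix t :: real and x :: 'a
    have "((\<lambda>t. G (x + t *\<^sub>R e)) has_derivative (\<lambda>h. G' (x + t *\<^sub>R e) (h *\<^sub>R e))) (at t)"
      by (rule has_derivative_compose[OF _ der, unfolded o_def]) (auto intro!: derivative_eq_intros)
    moreover have "(\<lambda>h. G' (x + t *\<^sub>R e) (h *\<^sub>R e)) = (*) (G' (x + t *\<^sub>R e) e)"
      using linear_scale[OF has_derivative_linear[OF der]] by (auto simp: fun_eq_iff mult.commute)
    ultimately show "((\<lambda>t. G (x + t *\<^sub>R e)) has_field_derivative G' (x + t *\<^sub>R e) e)
        (at t within {-1<..<1})"
      by (simp add: has_field_derivative_def has_derivative_at_withinI)
  next
    show "continuous_on ({-1<..<1} \<times> ?Q) (\<lambda>(t, x). G' (x + t *\<^sub>R e) e)"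
      unfolding split_beta by (intro continuous_intros continuous_on_compose2[OF cont]) auto
  qed (auto intro!: integrable_continuous continuous_intros continuous_on_compose2[OF contG])
  then have "((\<lambda>t. integral UNIV G) has_field_derivative integral ?Q (\<lambda>x. G' x e)) (at 0 within {-1<..<1})"
    unfolding scaleR_zero_left add_0_right
    by (rule has_field_derivative_transform_within[where d = 1]) (use shifted in auto)
  then have "((\<lambda>t. integral UNIV G) has_field_derivative integral ?Q (\<lambda>x. G' x e)) (at 0)"
    by (subst (asm) at_within_open) auto
  then show ?thesis
    using DERIV_const DERIV_unique by blast
qed

lemma integral_divergence_eq_0:
  fixes F :: "'a::euclidean_space \<Rightarrow> 'a"
  assumes der: "\<And>x. (F has_derivative F' x) (at x)"
    and cont: "\<And>h. continuous_on UNIV (\<lambda>x. F' x h)"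
    and supp: "\<And>x. norm x \<ge> 1 \<Longrightarrow> F x = 0"
  shows "integral (cbox (-2 *\<^sub>R One) (2 *\<^sub>R One)) (\<lambda>x. \<Sum>b\<in>Basis. F' x b \<bullet> b) = 0"
proof -
  have "integral (cbox (-2 *\<^sub>R One) (2 *\<^sub>R One)) (\<lambda>x. F' x b \<bullet> b) = 0" if "b \<in> Basis" for b
    by (rule integral_directional_derivative_eq_0[where G = "\<lambda>x. F x \<bullet> b" and G' = "\<lambda>x h. F' x h \<bullet> b"])
      (use that supp in \<open>auto intro!: has_derivative_inner_left der continuous_intros cont\<close>)
  moreover have "integral (cbox (-2 *\<^sub>R One) (2 *\<^sub>R One)) (\<lambda>x. \<Sum>b\<in>Basis. F' x b \<bullet> b)
      = (\<Sum>b\<in>Basis. integral (cbox (-2 *\<^sub>R One) (2 *\<^sub>R One)) (\<lambda>x. F' x b \<bullet> b))"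
    by (intro integral_sum integrable_continuous continuous_intros continuous_on_subset[OF cont]) auto
  ultimately show ?thesis by simp
qed


lemma integral_has_field_derivative_parameter:
  fixes f :: "real \<Rightarrow> 'a::euclidean_space \<Rightarrow> real"
  assumes "\<And>r y. ((\<lambda>r. f r y) has_field_derivative f' r y) (at r)"
    and "\<And>r. continuous_on UNIV (f r)"
    and "continuous_on UNIV (\<lambda>z. f' (fst z) (snd z))"
  shows "((\<lambda>r. integral (cbox a b) (f r)) has_field_derivative integral (cbox a b) (f' r)) (at r)"
proof (rule leibniz_rule_field_derivative[where U = UNIV])
  show "continuous_on (UNIV \<times> cbox a b) (\<lambda>(r, y). f' r y)"
    using assms(3) by (auto simp: split_beta intro: continuous_on_subset)
qed (use assms in \<open>auto intro!: integrable_continuous intro: continuous_on_subset\<close>)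

section \<open>The radial weight\<close>

definition bump :: "'a::real_inner \<Rightarrow> real" where
  "bump y = max 0 (1 - y \<bullet> y)"

lemma bump_nonneg [simp]: "bump y \<ge> 0"
  by (simp add: bump_def)

lemma bump_eq_0: "norm y \<ge> 1 \<Longrightarrow> bump y = 0"
  by (simp add: bump_def norm_eq_sqrt_inner)

lemma bump_pos: "norm y < 1 \<Longrightarrow> bump y > 0"
  by (simp add: bump_def norm_eq_sqrt_inner)

lemma continuous_on_bump [continuous_intros]:
  "continuous_on S f \<Longrightarrow> continuous_on S (\<lambda>x. bump (f x))"
  unfolding bump_def by (intro continuous_intros)

text \<open>\<open>bump\<close> has a kink at the unit sphere, but its square does not. An
  integration by parts therefore trades the weight \<open>bump\<close>, paired with the radial
  direction, for the weight \<open>(bump y)\<^sup>2\<close>, and both are continuous.\<close>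

lemma has_derivative_bump_square:
  "((\<lambda>y. - (bump y)\<^sup>2 / 4) has_derivative (\<lambda>h. bump y * (y \<bullet> h))) (at y)"
proof -
  have "((\<lambda>y. (max 0 (1 - y \<bullet> y))\<^sup>2) has_derivative
      (\<lambda>h. 2 * max 0 (1 - y \<bullet> y) * (- (y \<bullet> h) - h \<bullet> y))) (at y)"
    by (rule has_derivative_compose[OF _
          has_field_derivative_pos_part_square[unfolded has_field_derivative_def], unfolded o_def])
      (auto intro!: derivative_eq_intros)
  then have "((\<lambda>y. (bump y)\<^sup>2) has_derivative (\<lambda>h. - 4 * (bump y * (y \<bullet> h)))) (at y)"
    unfolding bump_def
    by (rule has_derivative_eq_rhs) (simp add: fun_eq_iff inner_commute algebra_simps)
  then have "((\<lambda>y. (- 1 / 4) * (bump y)\<^sup>2) has_derivative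
      (\<lambda>h. (- 1 / 4) * (- 4 * (bump y * (y \<bullet> h))))) (at y)"
    by (rule has_derivative_mult_right)
  then show ?thesis by simp
qed

text \<open>The gradient \<open>g\<close> and the Hessian \<open>H\<close> are given on the whole
  space, so the integrals below make sense at every scale; only the Laplace equation is confined to
  the ball of radius \<rho>.\<close>

locale harmonic_on_ball =
  fixes u :: "'a::euclidean_space \<Rightarrow> real" and g :: "'a \<Rightarrow> 'a" and H :: "'a \<Rightarrow> 'a \<Rightarrow> 'a" and \<rho> :: real
  assumes deriv_u: "\<And>x. (u has_derivative (\<lambda>h. g x \<bullet> h)) (at x)"
    and deriv_g: "\<And>x. (g has_derivative H x) (at x)"
    and cont_H: "\<And>h. continuous_on UNIV (\<lambda>x. H x h)"
    and sym_H: "\<And>x h k. H x h \<bullet> k = H x k \<bullet> h"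
    and harmonic: "\<And>x. norm x < \<rho> \<Longrightarrow> (\<Sum>b\<in>Basis. H x b \<bullet> b) = 0"
begin

abbreviation Q :: "'a set" where "Q \<equiv> cbox (-2 *\<^sub>R One) (2 *\<^sub>R One)"

text \<open>All integrals are rescaled to the fixed box \<open>Q\<close>, so that differentiation in
  \<open>r\<close> acts on the integrand alone. \<open>B\<close> is half the derivative of
  \<open>A\<close>, \<open>C\<close> is the radial energy, \<open>D\<close> the Dirichlet energy,
  and \<open>D'\<close> the derivative of \<open>D\<close>.\<close>

definition A :: "real \<Rightarrow> real" where
  "A r = integral Q (\<lambda>y. bump y * (u (r *\<^sub>R y))\<^sup>2)"

definition B :: "real \<Rightarrow> real" where
  "B r = integral Q (\<lambda>y. bump y * (u (r *\<^sub>R y) * (y \<bullet> g (r *\<^sub>R y))))"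

definition C :: "real \<Rightarrow> real" where
  "C r = integral Q (\<lambda>y. bump y * (y \<bullet> g (r *\<^sub>R y))\<^sup>2)"

definition D :: "real \<Rightarrow> real" where
  "D r = integral Q (\<lambda>y. (bump y)\<^sup>2 / 2 * (g (r *\<^sub>R y) \<bullet> g (r *\<^sub>R y)))"

definition D' :: "real \<Rightarrow> real" where
  "D' r = integral Q (\<lambda>y. (bump y)\<^sup>2 * (g (r *\<^sub>R y) \<bullet> H (r *\<^sub>R y) y))"

lemma cont_u [continuous_intros]: "continuous_on S f \<Longrightarrow> continuous_on S (\<lambda>z. u (f z))"
  by (rule continuous_on_compose2[of UNIV])
    (auto intro!: continuous_at_imp_continuous_on has_derivative_continuous deriv_u)

lemma cont_g [continuous_intros]: "continuous_on S f \<Longrightarrow> continuous_on S (\<lambda>z. g (f z))"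
  by (rule continuous_on_compose2[of UNIV])
    (auto intro!: continuous_at_imp_continuous_on has_derivative_continuous deriv_g)

lemma linear_H: "linear (H x)"
  using deriv_g has_derivative_linear by blast

lemma H_expand: "H x h = (\<Sum>b\<in>Basis. (h \<bullet> b) *\<^sub>R H x b)"
  by (subst euclidean_representation[of h, symmetric])
    (simp add: linear_sum[OF linear_H] linear_scale[OF linear_H] del: euclidean_representation)

text \<open>\<open>cont_H\<close> fixes the direction; linearity and an expansion in the basis
  upgrade it to joint continuity in point and direction.\<close>

lemma cont_H2 [continuous_intros]:
  assumes "continuous_on S p" "continuous_on S q"
  shows "continuous_on S (\<lambda>z. H (p z) (q z))"
  by (subst H_expand) (intro continuous_intros assms continuous_on_compose2[OF cont_H], auto)

lemma has_field_derivative_u_ray: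
  "((\<lambda>r. u (r *\<^sub>R y)) has_field_derivative y \<bullet> g (r *\<^sub>R y)) (at r)"
proof -
  have "((\<lambda>r. u (r *\<^sub>R y)) has_derivative (\<lambda>h. g (r *\<^sub>R y) \<bullet> (h *\<^sub>R y))) (at r)"
    by (rule has_derivative_compose[OF _ deriv_u, unfolded o_def]) (auto intro!: derivative_eq_intros)
  then show ?thesis
    unfolding has_field_derivative_def
    by (rule has_derivative_eq_rhs) (auto simp: fun_eq_iff inner_commute)
qed

lemma has_derivative_g_ray:
  "((\<lambda>r. g (r *\<^sub>R y)) has_derivative (\<lambda>h. h *\<^sub>R H (r *\<^sub>R y) y)) (at r)"
proof -
  have "((\<lambda>r. g (r *\<^sub>R y)) has_derivative (\<lambda>h. H (r *\<^sub>R y) (h *\<^sub>R y))) (at r)"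
    by (rule has_derivative_compose[OF _ deriv_g, unfolded o_def]) (auto intro!: derivative_eq_intros)
  then show ?thesis
    by (simp add: linear_scale[OF linear_H])
qed

lemma has_derivative_u_scaled:
  "((\<lambda>y. u (r *\<^sub>R y)) has_derivative (\<lambda>h. r * (g (r *\<^sub>R y) \<bullet> h))) (at y)"
proof -
  have "((\<lambda>y. u (r *\<^sub>R y)) has_derivative (\<lambda>h. g (r *\<^sub>R y) \<bullet> (r *\<^sub>R h))) (at y)"
    by (rule has_derivative_compose[OF _ deriv_u, unfolded o_def]) (auto intro!: derivative_eq_intros)
  then show ?thesis by simp
qed

lemma has_derivative_g_scaled:
  "((\<lambda>y. g (r *\<^sub>R y)) has_derivative (\<lambda>h. r *\<^sub>R H (r *\<^sub>R y) h)) (at y)"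
proof -
  have "((\<lambda>y. g (r *\<^sub>R y)) has_derivative (\<lambda>h. H (r *\<^sub>R y) (r *\<^sub>R h))) (at y)"
    by (rule has_derivative_compose[OF _ deriv_g, unfolded o_def]) (auto intro!: derivative_eq_intros)
  then show ?thesis
    by (simp add: linear_scale[OF linear_H])
qed

lemma A_deriv: "(A has_field_derivative 2 * B r) (at r)"
proof -
  have "((\<lambda>r. integral Q (\<lambda>y. bump y * (u (r *\<^sub>R y))\<^sup>2)) has_field_derivative
      integral Q (\<lambda>y. 2 * (bump y * (u (r *\<^sub>R y) * (y \<bullet> g (r *\<^sub>R y)))))) (at r)"
    by (rule integral_has_field_derivative_parameter)
      (auto intro!: derivative_eq_intros continuous_intros has_field_derivative_u_ray)
  then show ?thesis
    by (simp add: A_def[abs_def] B_def)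
qed

lemma D_deriv: "(D has_field_derivative D' r) (at r)"
proof -
  have *: "((\<lambda>r. (bump y)\<^sup>2 / 2 * (g (r *\<^sub>R y) \<bullet> g (r *\<^sub>R y))) has_field_derivative
     (bump y)\<^sup>2 * (g (r *\<^sub>R y) \<bullet> H (r *\<^sub>R y) y)) (at r)" for r y
    unfolding has_field_derivative_def
    by (rule has_derivative_eq_rhs, rule has_derivative_mult_right,
        rule has_derivative_inner[OF has_derivative_g_ray has_derivative_g_ray])
      (auto simp: fun_eq_iff inner_commute algebra_simps)
  show ?thesis
    unfolding D_def[abs_def] D'_def
    by (rule integral_has_field_derivative_parameter[OF *]) (auto intro!: continuous_intros)
qed

text \<open>The divergence of \<open>- (bump y)\<^sup>2 / 4\<close> times \<open>u g\<close> at
  \<open>r *\<^sub>R y\<close> integrates to zero. The derivative of the weight gives the integrand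
  of \<open>B\<close>, that of \<open>u\<close> the integrand of \<open>D\<close>, and that of
  \<open>g\<close> a multiple of the Laplacian of \<open>u\<close>.\<close>

lemma B_eq:
  assumes "0 < r" "r \<le> \<rho>"
  shows "2 * B r = r * D r"
proof -
  let ?F = "\<lambda>y. (- (bump y)\<^sup>2 / 4 * u (r *\<^sub>R y)) *\<^sub>R g (r *\<^sub>R y)"
  let ?F' = "\<lambda>y h. (- (bump y)\<^sup>2 / 4 * u (r *\<^sub>R y)) *\<^sub>R (r *\<^sub>R H (r *\<^sub>R y) h)
     + (- (bump y)\<^sup>2 / 4 * (r * (g (r *\<^sub>R y) \<bullet> h)) + bump y * (y \<bullet> h) * u (r *\<^sub>R y)) *\<^sub>R g (r *\<^sub>R y)"
  have "integral Q (\<lambda>y. \<Sum>b\<in>Basis. ?F' y b \<bullet> b) = 0"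
  proof (rule integral_divergence_eq_0[where F = ?F])
    show "(?F has_derivative ?F' y) (at y)" for y
      by (intro has_derivative_scaleR has_derivative_mult has_derivative_bump_square
          has_derivative_u_scaled has_derivative_g_scaled)
  qed (auto simp: bump_eq_0 intro!: continuous_intros)
  moreover have "(\<Sum>b\<in>Basis. ?F' y b \<bullet> b) = bump y * (u (r *\<^sub>R y) * (y \<bullet> g (r *\<^sub>R y)))
      - r / 2 * ((bump y)\<^sup>2 / 2 * (g (r *\<^sub>R y) \<bullet> g (r *\<^sub>R y)))" for y
  proof -
    \<comment> \<open>Inside the unit ball \<open>r *\<^sub>R y\<close> stays in the ball of
      harmonicity because \<open>r \<le> \<rho>\<close>; outside it the weight vanishes.\<close>
    have "(bump y)\<^sup>2 * (\<Sum>b\<in>Basis. H (r *\<^sub>R y) b \<bullet> b) = 0"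
    proof (cases "norm y < 1")
      case True
      then have "r * norm y < r * 1"
        using assms by (intro mult_strict_left_mono) auto
      then have "norm (r *\<^sub>R y) < \<rho>"
        unfolding norm_scaleR using assms by linarith
      then show ?thesis
        by (simp add: harmonic)
    qed (simp add: bump_eq_0)
    then have tr: "(\<Sum>b\<in>Basis. (- (bump y)\<^sup>2 / 4 * u (r *\<^sub>R y) * r) * (H (r *\<^sub>R y) b \<bullet> b)) = 0"
      unfolding sum_distrib_left[symmetric] by auto
    have "(\<Sum>b\<in>Basis. ?F' y b \<bullet> b)
        = (\<Sum>b\<in>Basis. (- (bump y)\<^sup>2 / 4 * u (r *\<^sub>R y) * r) * (H (r *\<^sub>R y) b \<bullet> b))
          + - (bump y)\<^sup>2 / 4 * r * (\<Sum>b\<in>Basis. (g (r *\<^sub>R y) \<bullet> b) * (g (r *\<^sub>R y) \<bullet> b))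
          + bump y * u (r *\<^sub>R y) * (\<Sum>b\<in>Basis. (y \<bullet> b) * (g (r *\<^sub>R y) \<bullet> b))"
      by (simp add: sum_distrib_left flip: sum.distrib) (simp add: algebra_simps)
    then show ?thesis
      unfolding tr euclidean_inner[symmetric] by (simp add: algebra_simps)
  qed
  ultimately have "integral Q (\<lambda>y. bump y * (u (r *\<^sub>R y) * (y \<bullet> g (r *\<^sub>R y)))
      - r / 2 * ((bump y)\<^sup>2 / 2 * (g (r *\<^sub>R y) \<bullet> g (r *\<^sub>R y)))) = 0"
    by simp
  then have "B r - r / 2 * D r = 0"
    unfolding B_def D_def
    by (subst (asm) integral_diff)
      (auto simp del: times_divide_eq_left times_divide_eq_right intro!: integrable_continuous continuous_intros)
  then show ?thesis by simp
qed

text \<open>A Rellich-Pohozaev identity: the same argument as for \<open>B_eq\<close>, with the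
  radial derivative \<open>y \<bullet> g\<close> in place of \<open>u\<close>. Symmetry of the
  Hessian turns \<open>y \<bullet> H b\<close> into \<open>H y \<bullet> b\<close>, which sums up to
  the integrand of \<open>D'\<close>.\<close>

lemma C_eq:
  assumes "0 < r" "r \<le> \<rho>"
  shows "4 * C r = 2 * D r + r * D' r"
proof -
  let ?g = "\<lambda>y. g (r *\<^sub>R y)" and ?H = "\<lambda>y. H (r *\<^sub>R y)"
  let ?F = "\<lambda>y. (- (bump y)\<^sup>2 / 4 * (y \<bullet> ?g y)) *\<^sub>R ?g y"
  let ?F' = "\<lambda>y h. (- (bump y)\<^sup>2 / 4 * (y \<bullet> ?g y)) *\<^sub>R (r *\<^sub>R ?H y h)
     + (- (bump y)\<^sup>2 / 4 * (y \<bullet> (r *\<^sub>R ?H y h) + h \<bullet> ?g y) + bump y * (y \<bullet> h) * (y \<bullet> ?g y)) *\<^sub>R ?g y"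
  have "integral Q (\<lambda>y. \<Sum>b\<in>Basis. ?F' y b \<bullet> b) = 0"
  proof (rule integral_divergence_eq_0[where F = ?F])
    show "(?F has_derivative ?F' y) (at y)" for y
      by (intro has_derivative_scaleR has_derivative_mult has_derivative_inner has_derivative_ident
          has_derivative_bump_square has_derivative_g_scaled)
  qed (auto simp: bump_eq_0 intro!: continuous_intros)
  moreover have "(\<Sum>b\<in>Basis. ?F' y b \<bullet> b) = bump y * (y \<bullet> ?g y)\<^sup>2
      - (1 / 2 * ((bump y)\<^sup>2 / 2 * (?g y \<bullet> ?g y)) + r / 4 * ((bump y)\<^sup>2 * (?g y \<bullet> ?H y y)))" for y
  proof -
    have "(bump y)\<^sup>2 * (\<Sum>b\<in>Basis. ?H y b \<bullet> b) = 0"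
    proof (cases "norm y < 1")
      case True
      then have "r * norm y < r * 1"
        using assms by (intro mult_strict_left_mono) auto
      then have "norm (r *\<^sub>R y) < \<rho>"
        unfolding norm_scaleR using assms by linarith
      then show ?thesis
        by (simp add: harmonic)
    qed (simp add: bump_eq_0)
    then have tr: "(\<Sum>b\<in>Basis. (- (bump y)\<^sup>2 / 4 * (y \<bullet> ?g y) * r) * (?H y b \<bullet> b)) = 0"
      unfolding sum_distrib_left[symmetric] by auto
    have "y \<bullet> ?H y b = ?H y y \<bullet> b" for b
      using sym_H[of "r *\<^sub>R y" b y] by (simp add: inner_commute)
    then have "(\<Sum>b\<in>Basis. ?F' y b \<bullet> b)
        = (\<Sum>b\<in>Basis. (- (bump y)\<^sup>2 / 4 * (y \<bullet> ?g y) * r) * (?H y b \<bullet> b))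
          + - (bump y)\<^sup>2 / 4 * r * (\<Sum>b\<in>Basis. (?g y \<bullet> b) * (?H y y \<bullet> b))
          + - (bump y)\<^sup>2 / 4 * (\<Sum>b\<in>Basis. (?g y \<bullet> b) * (?g y \<bullet> b))
          + bump y * (y \<bullet> ?g y) * (\<Sum>b\<in>Basis. (y \<bullet> b) * (?g y \<bullet> b))"
      unfolding sum_distrib_left sum.distrib[symmetric]
      by (intro sum.cong refl) (simp add: algebra_simps add_divide_distrib inner_commute)
    then show ?thesis
      unfolding tr euclidean_inner[symmetric] by (simp add: algebra_simps power2_eq_square)
  qed
  ultimately have "integral Q (\<lambda>y. bump y * (y \<bullet> ?g y)\<^sup>2
      - (1 / 2 * ((bump y)\<^sup>2 / 2 * (?g y \<bullet> ?g y)) + r / 4 * ((bump y)\<^sup>2 * (?g y \<bullet> ?H y y)))) = 0"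
    by simp
  then have "C r - (1 / 2 * D r + r / 4 * D' r) = 0"
    unfolding C_def D_def D'_def
    by (subst (asm) integral_diff, (auto intro!: integrable_continuous continuous_intros)[2],
        subst (asm) integral_add, (auto intro!: integrable_continuous continuous_intros)[2])
      (simp del: times_divide_eq_left times_divide_eq_right)
  then show ?thesis by simp
qed

text \<open>The weighted square of \<open>y \<bullet> g - q * u\<close> has a nonnegative integral,
  and \<open>q = B r / A r\<close> is the minimizing choice of \<open>q\<close>.\<close>

lemma Cauchy_Schwarz_ABC: "(B r)\<^sup>2 \<le> A r * C r" if "A r > 0"
proof -
  define q where "q = B r / A r"
  let ?a = "\<lambda>y. bump y * (u (r *\<^sub>R y))\<^sup>2"
    and ?b = "\<lambda>y. bump y * (u (r *\<^sub>R y) * (y \<bullet> g (r *\<^sub>R y)))"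
    and ?c = "\<lambda>y. bump y * (y \<bullet> g (r *\<^sub>R y))\<^sup>2"
  have int: "?a integrable_on Q" "?b integrable_on Q" "?c integrable_on Q"
    by (auto intro!: integrable_continuous continuous_intros)
  have "0 \<le> integral Q (\<lambda>y. bump y * (y \<bullet> g (r *\<^sub>R y) - q * u (r *\<^sub>R y))\<^sup>2)"
    by (intro integral_nonneg integrable_continuous continuous_intros) auto
  also have "\<dots> = integral Q (\<lambda>y. (?c y + q\<^sup>2 * ?a y) - 2 * q * ?b y)"
    by (intro arg_cong[of _ _ "integral Q"]) (auto simp: fun_eq_iff power2_eq_square algebra_simps)
  also have "\<dots> = (C r + q\<^sup>2 * A r) - 2 * q * B r"
    unfolding A_def B_def C_def
    by (subst integral_diff, (auto intro!: integrable_continuous continuous_intros)[2],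
        subst integral_add, (auto intro!: integrable_continuous continuous_intros)[2]) simp
  also have "\<dots> = C r - (B r)\<^sup>2 / A r"
    using that by (simp add: q_def power2_eq_square field_simps)
  finally show ?thesis
    using that by (simp add: field_simps)
qed

lemma A_nonneg: "A r \<ge> 0"
  unfolding A_def by (intro integral_nonneg integrable_continuous continuous_intros) auto

lemma D_nonneg: "D r \<ge> 0"
  unfolding D_def by (intro integral_nonneg integrable_continuous continuous_intros) auto

text \<open>The integrand is continuous and nonnegative, and its weight is positive inside the unit
  ball. Unique continuation thereby becomes a question about the zeros of the scalar function
  \<open>A\<close>.\<close>

lemma A_eq_0_iff:
  assumes "r > 0"
  shows "A r = 0 \<longleftrightarrow> (\<forall>x. norm x < r \<longrightarrow> u x = 0)"
proof
  assume "A r = 0"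
  let ?f = "\<lambda>y. bump y * (u (r *\<^sub>R y))\<^sup>2"
  have cont: "continuous_on Q ?f"
    by (intro continuous_intros)
  then have "(?f has_integral 0) Q"
    using \<open>A r = 0\<close> integrable_integral[OF integrable_continuous[OF cont]] by (simp add: A_def)
  then have zero: "?f y = 0" if "y \<in> Q" for y
    using that by (intro has_integral_0_cbox_imp_0[OF cont]) (auto simp: box_ne_empty)
  show "\<forall>x. norm x < r \<longrightarrow> u x = 0"
  proof (intro allI impI)
    fix x :: 'a assume "norm x < r"
    define y where "y = (1 / r) *\<^sub>R x"
    have y: "norm y < 1" "x = r *\<^sub>R y"
      using assms \<open>norm x < r\<close> by (auto simp: y_def)
    have "y \<in> Q"
      unfolding mem_box
    proof
      fix b :: 'a assume "b \<in> Basis"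
      then show "(-2 *\<^sub>R One) \<bullet> b \<le> y \<bullet> b \<and> y \<bullet> b \<le> (2 *\<^sub>R One) \<bullet> b"
        using Basis_le_norm[of b y] y(1) by auto
    qed
    from zero[OF this] show "u x = 0"
      using bump_pos[OF y(1)] y(2) by auto
  qed
next
  assume u: "\<forall>x. norm x < r \<longrightarrow> u x = 0"
  have *: "bump y * (u (r *\<^sub>R y))\<^sup>2 = 0" for y
  proof (cases "norm y < 1")
    case True
    then have "r * norm y < r * 1"
      using assms by (intro mult_strict_left_mono) auto
    with u assms show ?thesis by simp
  qed (simp add: bump_eq_0)
  show "A r = 0" unfolding A_def * by simp
qed

text \<open>Almgren's frequency function.\<close>

definition N :: "real \<Rightarrow> real" where
  "N r = r\<^sup>2 * D r / A r"

text \<open>By \<open>B_eq\<close> and \<open>C_eq\<close> the numerator of the derivative of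
  \<open>N\<close> collapses to \<open>4 * r * (A r * C r - (B r)\<^sup>2)\<close>, which is
  nonnegative by Cauchy-Schwarz.\<close>

lemma N_mono:
  assumes "0 < a" "a \<le> b" "b \<le> \<rho>" "\<And>r. r \<in> {a..b} \<Longrightarrow> A r > 0"
  shows "N a \<le> N b"
proof (rule DERIV_nonneg_imp_nondecreasing[OF \<open>a \<le> b\<close>])
  fix r assume r: "a \<le> r" "r \<le> b"
  then have A: "A r > 0" and "0 < r" "r \<le> \<rho>"
    using assms by auto
  note eqs = B_eq[OF this(2,3)] C_eq[OF this(2,3)]
  have *: "(N has_field_derivative
      ((2 * r * D r + r\<^sup>2 * D' r) * A r - r\<^sup>2 * D r * (2 * B r)) / (A r * A r)) (at r)"
    unfolding N_def[abs_def]
    by (rule derivative_eq_intros A_deriv D_deriv | use A in simp)+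
  have 1: "2 * r * D r + r\<^sup>2 * D' r = 4 * r * C r"
    using eqs(2) by (simp add: power2_eq_square algebra_simps)
  have 2: "r\<^sup>2 * D r * (2 * B r) = 4 * r * (B r)\<^sup>2"
  proof -
    have "r\<^sup>2 * D r * (2 * B r) = r * (r * D r) * (2 * B r)"
      by (simp add: power2_eq_square)
    then show ?thesis
      unfolding eqs(1)[symmetric] by (simp add: power2_eq_square)
  qed
  with * have "(N has_field_derivative
      (4 * r * (A r * C r - (B r)\<^sup>2)) / (A r * A r)) (at r)"
    unfolding 1 2 by (simp add: algebra_simps)
  moreover have "(4 * r * (A r * C r - (B r)\<^sup>2)) / (A r * A r) \<ge> 0"
    using Cauchy_Schwarz_ABC[OF A] \<open>0 < r\<close> by simp
  ultimately show "\<exists>y. (N has_field_derivative y) (at r) \<and> 0 \<le> y"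
    by blast
qed

text \<open>Below the radius \<open>b\<close> the frequency is at most \<open>N b\<close>, hence \<open>A' \<le> K A\<close>: as \<open>r\<close> decreases,
  \<open>A\<close> cannot drop to \<open>0\<close>.\<close>

lemma unique_continuation:
  assumes "0 < R" "\<And>x. norm x < R \<Longrightarrow> u x = 0" "norm x < \<rho>"
  shows "u x = 0"
proof (rule ccontr)
  assume "u x \<noteq> 0"
  \<comment> \<open>A radius strictly between \<open>norm x\<close> and \<rho>: the ball of radius
    \<open>b\<close> contains the point where \<open>u\<close> is nonzero, so \<open>A b\<close> is
    nonzero.\<close>
  define b where "b = (norm x + \<rho>) / 2"
  have b: "norm x < b" "b < \<rho>"
    using assms by (auto simp: b_def)
  with \<open>u x \<noteq> 0\<close> assms have "R < b" by force
  have AR: "A R = 0" and Ab: "A b \<noteq> 0"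
    using A_eq_0_iff[of R] A_eq_0_iff[of b] assms \<open>u x \<noteq> 0\<close> b(1) \<open>R < b\<close> by auto
  have contA: "continuous_on S A" for S
    by (meson A_deriv DERIV_continuous continuous_at_imp_continuous_on)
  let ?Z = "{r \<in> {R..b}. A r = 0}"
  have "compact ?Z"
    using continuous_closed_preimage[OF contA, of "{R..b}" "{0}"]
    by (auto simp: compact_eq_bounded_closed vimage_def Int_def intro: bounded_subset[of "{R..b}"])
  moreover have "R \<in> ?Z"
    using AR \<open>R < b\<close> by simp
  \<comment> \<open>\<open>a\<close> is the last zero of \<open>A\<close> before \<open>b\<close>,
    so \<open>A\<close> is positive from there up to \<open>b\<close> and the frequency is well
    behaved.\<close>
  ultimately obtain a where a: "a \<in> ?Z" "\<And>r. r \<in> ?Z \<Longrightarrow> r \<le> a"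
    using compact_attains_sup[of ?Z] by blast
  then have "a < b" "0 < a" "A a = 0"
    using Ab assms(1) by (auto simp: less_le)
  have pos: "A r > 0" if "a < r" "r \<le> b" for r
  proof -
    have "A r \<noteq> 0"
      using a(2)[of r] that a(1) by auto
    then show ?thesis
      using A_nonneg[of r] by simp
  qed
  define K where "K = N b / a"
  have N_b: "N b \<ge> 0"
    using D_nonneg A_nonneg by (simp add: N_def)
  have lower: "A b * exp (- K * b) \<le> A r * exp (- K * r)" if r: "a < r" "r \<le> b" for r
  proof (rule DERIV_nonpos_imp_nonincreasing[OF r(2)])
    fix t assume t: "r \<le> t" "t \<le> b"
    then have At: "A t > 0" and "0 < t"
      using pos r \<open>0 < a\<close> by auto
    \<comment> \<open>By \<open>B_eq\<close> the frequency is the logarithmic derivative: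
      \<open>N t\<close> equals \<open>t\<close> times the derivative of \<open>A\<close>, divided
      by \<open>A t\<close>.\<close>
    have "t * (2 * B t) = N t * A t"
      using B_eq[of t] At \<open>0 < t\<close> t b by (simp add: N_def power2_eq_square)
    also have "\<dots> \<le> N b * A t"
      using At N_mono[of t b] pos t r \<open>0 < t\<close> b by (intro mult_right_mono) (auto intro: less_imp_le)
    also have "\<dots> = a * K * A t"
      using \<open>0 < a\<close> by (simp add: K_def)
    also have "\<dots> \<le> t * K * A t"
      using t r At N_b \<open>0 < a\<close> by (intro mult_right_mono) (auto simp: K_def)
    finally have "2 * B t \<le> K * A t"
      using \<open>0 < t\<close> by (simp add: mult.assoc)
    then have "(2 * B t - K * A t) * exp (- K * t) \<le> 0"
      by (intro mult_nonpos_nonneg) auto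
    moreover have "((\<lambda>t. A t * exp (- K * t)) has_field_derivative
        (2 * B t - K * A t) * exp (- K * t)) (at t)"
      by (auto intro!: derivative_eq_intros A_deriv simp: algebra_simps)
    ultimately show "\<exists>y. ((\<lambda>t. A t * exp (- K * t)) has_field_derivative y) (at t) \<and> y \<le> 0"
      by blast
  qed
  \<comment> \<open>The Gronwall bound \<open>lower\<close> holds to the right of \<open>a\<close>
    only; continuity carries it to \<open>a\<close>, where its right side is zero and its left side
    positive.\<close>
  have "A b * exp (- K * b) \<le> A a * exp (- K * a)"
  proof (rule tendsto_lowerbound)
    have "isCont (\<lambda>r. A r * exp (- K * r)) a"
      by (intro continuous_intros DERIV_isCont[OF A_deriv])
    then show "((\<lambda>r. A r * exp (- K * r)) \<longlongrightarrow> A a * exp (- K * a)) (at_right a)"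
      by (simp add: isCont_def filterlim_at_split)
    show "\<forall>\<^sub>F r in at_right a. A b * exp (- K * b) \<le> A r * exp (- K * r)"
      using lower \<open>a < b\<close> by (auto simp: eventually_at_right_field intro!: exI[of _ b])
  qed simp
  then show False
    using \<open>A a = 0\<close> pos[of b] \<open>a < b\<close> by (simp add: mult_le_0_iff)
qed

end

section \<open>Mixed partial derivatives\<close>

text \<open>Existence of the second mixed derivative is part of the conclusion. Integrate
  \<open>\<phi>t\<close> in \<open>t\<close>, differentiate under the integral in \<open>r\<close>
  to represent \<open>\<phi>r\<close> as an integral of \<open>\<phi>tr\<close>, and apply the
  fundamental theorem of calculus.\<close>

lemma mixed_partials:
  fixes \<phi> :: "real \<Rightarrow> real \<Rightarrow> 'b::banach"
  assumes deriv_t: "\<And>r t. r \<in> {a<..<b} \<Longrightarrow> t \<in> {c<..<d} \<Longrightarrow>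
      ((\<lambda>t. \<phi> r t) has_vector_derivative \<phi>t r t) (at t)"
    and deriv_r: "\<And>r t. r \<in> {a<..<b} \<Longrightarrow> t \<in> {c<..<d} \<Longrightarrow>
      ((\<lambda>r. \<phi> r t) has_vector_derivative \<phi>r r t) (at r)"
    and deriv_tr: "\<And>r t. r \<in> {a<..<b} \<Longrightarrow> t \<in> {c<..<d} \<Longrightarrow>
      ((\<lambda>r. \<phi>t r t) has_vector_derivative \<phi>tr r t) (at r)"
    and cont_t: "\<And>r. r \<in> {a<..<b} \<Longrightarrow> continuous_on {c<..<d} (\<phi>t r)"
    and cont_tr: "continuous_on ({a<..<b} \<times> {c<..<d}) (\<lambda>(r, t). \<phi>tr r t)"
    and r\<^sub>0: "r\<^sub>0 \<in> {a<..<b}" and t\<^sub>0: "t\<^sub>0 \<in> {c<..<d}"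
  shows "((\<lambda>t. \<phi>r r\<^sub>0 t) has_vector_derivative \<phi>tr r\<^sub>0 t\<^sub>0) (at t\<^sub>0)"
proof -
  obtain p q where pq: "c < p" "p < t\<^sub>0" "t\<^sub>0 < q" "q < d"
    using t\<^sub>0 dense by (metis greaterThanLessThan_iff)
  have sub: "{p..t} \<subseteq> {c<..<d}" if "t \<le> q" for t
    using pq that by auto
  have repr: "\<phi>r r\<^sub>0 t = \<phi>r r\<^sub>0 p + integral {p..t} (\<phi>tr r\<^sub>0)" if t: "t \<in> {p..q}" for t
  proof -
    have leibniz: "((\<lambda>r. integral (cbox p t) (\<phi>t r)) has_vector_derivative integral (cbox p t) (\<phi>tr r\<^sub>0))
        (at r\<^sub>0 within {a<..<b})"
    proof (rule leibniz_rule_vector_derivative)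
      show "\<phi>t r integrable_on cbox p t" if "r \<in> {a<..<b}" for r
        using continuous_on_subset[OF cont_t[OF that] sub[of t]] t
        by (simp add: integrable_continuous_real)
      show "continuous_on ({a<..<b} \<times> cbox p t) (\<lambda>(r, t). \<phi>tr r t)"
        by (rule continuous_on_subset[OF cont_tr]) (use sub[of t] t in auto)
      show "((\<lambda>r. \<phi>t r \<tau>) has_vector_derivative \<phi>tr r \<tau>) (at r within {a<..<b})"
        if "r \<in> {a<..<b}" "\<tau> \<in> cbox p t" for r \<tau>
        using that sub[of t] t by (intro has_vector_derivative_at_within[OF deriv_tr]) auto
    qed (use r\<^sub>0 in auto)
    have ftc: "integral (cbox p t) (\<phi>t r) = \<phi> r t - \<phi> r p" if r: "r \<in> {a<..<b}" for r
    proof -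
      have "((\<phi> r) has_vector_derivative \<phi>t r \<tau>) (at \<tau> within {p..t})" if "\<tau> \<in> {p..t}" for \<tau>
        using that sub[of t] t by (intro has_vector_derivative_at_within[OF deriv_t] r) auto
      then have "(\<phi>t r has_integral \<phi> r t - \<phi> r p) {p..t}"
        using t by (intro fundamental_theorem_of_calculus) simp_all
      then show ?thesis
        unfolding cbox_interval by (rule integral_unique)
    qed
    have "((\<lambda>r. \<phi> r t - \<phi> r p) has_vector_derivative integral (cbox p t) (\<phi>tr r\<^sub>0))
        (at r\<^sub>0 within {a<..<b})"
      by (rule has_vector_derivative_transform[OF r\<^sub>0 _ leibniz]) (erule ftc[symmetric])
    then have "((\<lambda>r. \<phi> r t - \<phi> r p) has_vector_derivative integral {p..t} (\<phi>tr r\<^sub>0)) (at r\<^sub>0)"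
      using at_within_open[OF r\<^sub>0] by simp
    moreover have "((\<lambda>r. \<phi> r t - \<phi> r p) has_vector_derivative \<phi>r r\<^sub>0 t - \<phi>r r\<^sub>0 p) (at r\<^sub>0)"
      using r\<^sub>0 pq t by (intro has_vector_derivative_diff deriv_r) auto
    ultimately show ?thesis
      by (auto dest: vector_derivative_unique_at simp: algebra_simps)
  qed
  have "continuous_on {p..q} (\<phi>tr r\<^sub>0)"
  proof -
    have "continuous_on {p..q} (\<lambda>t. case (r\<^sub>0, t) of (r, t) \<Rightarrow> \<phi>tr r t)"
      by (rule continuous_on_compose2[OF cont_tr]) (use r\<^sub>0 pq in \<open>auto intro!: continuous_intros\<close>)
    then show ?thesis by simp
  qed
  then have *: "((\<lambda>t. \<phi>r r\<^sub>0 p + integral {p..t} (\<phi>tr r\<^sub>0)) has_vector_derivative \<phi>tr r\<^sub>0 t\<^sub>0)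
      (at t\<^sub>0 within {p..q})"
    using pq by (auto intro!: derivative_eq_intros integral_has_vector_derivative)
  have "((\<lambda>t. \<phi>r r\<^sub>0 t) has_vector_derivative \<phi>tr r\<^sub>0 t\<^sub>0) (at t\<^sub>0 within {p..q})"
    by (rule has_vector_derivative_transform[OF _ repr *]) (use pq in auto)
  then show ?thesis
    using pq by (simp add: at_within_Icc_at)
qed

text \<open>Restriction to the plane through \<open>x\<close> spanned by \<open>h\<close> and
  \<open>k\<close> reduces the claim to \<open>mixed_partials\<close>, followed by uniqueness of the
  derivative.\<close>

lemma symmetric_second_derivative:
  fixes f :: "'a::real_normed_vector \<Rightarrow> 'b::banach"
  assumes "open S" "x \<in> S"
    and f': "\<And>y. y \<in> S \<Longrightarrow> (f has_derivative f' y) (at y)"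
    and Fh: "\<And>y. y \<in> S \<Longrightarrow> ((\<lambda>y. f' y h) has_derivative Fh y) (at y)"
    and Fk: "((\<lambda>y. f' y k) has_derivative Fk) (at x)"
    and cont: "continuous_on S (\<lambda>y. Fh y k)"
  shows "Fh x k = Fk h"
proof -
  obtain e where e: "e > 0" "ball x e \<subseteq> S"
    using assms(1,2) openE by blast
  \<comment> \<open>Keeps the parallelogram of parameters inside the ball; the summand 1 covers
    \<open>h = k = 0\<close>.\<close>
  define d where "d = e / (norm h + norm k + 1)"
  have pos: "norm h + norm k + 1 > 0"
    by (simp add: add_nonneg_pos)
  then have "d > 0" using e by (simp add: d_def)
  have S: "x + r *\<^sub>R k + t *\<^sub>R h \<in> S" if "r \<in> {-d<..<d}" "t \<in> {-d<..<d}" for r t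
  proof -
    have "norm (r *\<^sub>R k + t *\<^sub>R h) \<le> \<bar>r\<bar> * norm k + \<bar>t\<bar> * norm h"
      by (metis norm_scaleR norm_triangle_ineq)
    also have "\<dots> \<le> d * norm k + d * norm h"
      using that by (intro add_mono mult_right_mono) auto
    also have "\<dots> < d * (norm h + norm k + 1)"
      using \<open>d > 0\<close> by (simp add: algebra_simps)
    also have "\<dots> = e"
      using pos by (simp add: d_def)
    finally have "x + (r *\<^sub>R k + t *\<^sub>R h) \<in> ball x e"
      by (metis add_diff_cancel_left' dist_commute dist_norm mem_ball)
    then show ?thesis using e by (auto simp: add.assoc)
  qed
  have line: "((\<lambda>r. g (p + r *\<^sub>R v)) has_vector_derivative g' v) (at r)"
    if "(g has_derivative g') (at (p + r *\<^sub>R v))" for g :: "'a \<Rightarrow> 'b" and g' p v r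
  proof -
    have "((\<lambda>r. g (p + r *\<^sub>R v)) has_derivative (\<lambda>s. g' (s *\<^sub>R v))) (at r)"
      by (rule has_derivative_compose[where f = "\<lambda>r. p + r *\<^sub>R v" and g = g, OF _ that]) (auto intro!: derivative_eq_intros)
    then show ?thesis
      using linear_scale[OF has_derivative_linear[OF that]] by (simp add: has_vector_derivative_def)
  qed
  have swap: "x + r *\<^sub>R k + t *\<^sub>R h = (x + t *\<^sub>R h) + r *\<^sub>R k" for r t
    by simp
  have "((\<lambda>t. f' (x + 0 *\<^sub>R k + t *\<^sub>R h) k) has_vector_derivative Fh (x + 0 *\<^sub>R k + 0 *\<^sub>R h) k) (at 0)"
  proof (rule mixed_partials[where a = "-d" and b = d and c = "-d" and d = d
        and r\<^sub>0 = 0 and t\<^sub>0 = 0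
        and \<phi> = "\<lambda>r t. f (x + r *\<^sub>R k + t *\<^sub>R h)"
        and \<phi>r = "\<lambda>r t. f' (x + r *\<^sub>R k + t *\<^sub>R h) k"
        and \<phi>tr = "\<lambda>r t. Fh (x + r *\<^sub>R k + t *\<^sub>R h) k"
        and \<phi>t = "\<lambda>r t. f' (x + r *\<^sub>R k + t *\<^sub>R h) h"])
    fix r t assume rt: "r \<in> {-d<..<d}" "t \<in> {-d<..<d}"
    show "((\<lambda>t. f (x + r *\<^sub>R k + t *\<^sub>R h)) has_vector_derivative f' (x + r *\<^sub>R k + t *\<^sub>R h) h) (at t)"
      by (intro line f' S rt)
    show "((\<lambda>r. f (x + r *\<^sub>R k + t *\<^sub>R h)) has_vector_derivative f' (x + r *\<^sub>R k + t *\<^sub>R h) k) (at r)"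
      unfolding swap using f'[OF S[OF rt]] by (intro line) (simp add: swap)
    show "((\<lambda>r. f' (x + r *\<^sub>R k + t *\<^sub>R h) h) has_vector_derivative Fh (x + r *\<^sub>R k + t *\<^sub>R h) k) (at r)"
      unfolding swap using Fh[OF S[OF rt]] by (intro line[where g = "\<lambda>y. f' y h"]) (simp add: swap)
  next
    fix r assume r: "r \<in> {-d<..<d}"
    have "continuous_on S (\<lambda>y. f' y h)"
      by (intro continuous_at_imp_continuous_on ballI has_derivative_continuous[OF Fh])
    then show "continuous_on {-d<..<d} (\<lambda>t. f' (x + r *\<^sub>R k + t *\<^sub>R h) h)"
      by (rule continuous_on_compose2) (auto intro!: continuous_intros S[OF r])
  next
    show "continuous_on ({-d<..<d} \<times> {-d<..<d}) (\<lambda>(r, t). Fh (x + r *\<^sub>R k + t *\<^sub>R h) k)"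
      unfolding split_beta
      by (rule continuous_on_compose2[OF cont]) (auto intro!: continuous_intros S)
  qed (use \<open>d > 0\<close> in auto)
  moreover have "((\<lambda>t. f' (x + t *\<^sub>R h) k) has_vector_derivative Fk h) (at 0)"
    using Fk by (intro line[where g = "\<lambda>y. f' y k"]) simp
  ultimately show ?thesis
    by (auto dest: vector_derivative_unique_at)
qed

section \<open>Maximum principles for time periodic functions\<close>

lemma time_periodic_reduce:
  assumes "time_periodic S f"
  shows "f (y, s - S * of_int k) = f (y, s)"
proof -
  have nat: "f (y, s + S * real n) = f (y, s)" for n s
  proof (induction n)
    case (Suc n)
    have "f (y, s + S * real (Suc n)) = f (y, (s + S * real n) + S)"
      by (simp add: algebra_simps)
    also have "\<dots> = f (y, s + S * real n)"
      using assms unfolding time_periodic_def by metis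
    finally show ?case using Suc by simp
  qed simp
  show ?thesis
  proof (cases "k \<ge> 0")
    case True
    then show ?thesis
      using nat[of "s - S * of_int k" "nat k"] by simp
  next
    case False
    then show ?thesis
      using nat[of s "nat (- k)"] by simp
  qed
qed

lemma mod_period_bounds:
  assumes "S > 0"
  shows "s - S * of_int \<lfloor>s / S\<rfloor> \<in> {0..<S}"
proof -
  have "S * of_int \<lfloor>s / S\<rfloor> \<le> S * (s / S)" "S * (s / S) < S * (of_int \<lfloor>s / S\<rfloor> + 1)"
    using assms by (intro mult_left_mono mult_strict_left_mono; linarith)+
  then show ?thesis
    using assms by (simp add: algebra_simps)
qed

text \<open>Time can be shifted into \<open>{0..S}\<close>, so a maximum over the compact cylinder
  is a maximum over all times.\<close>

lemma periodic_attains_max: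
  fixes h :: "spacetime \<Rightarrow> real"
  assumes "S > 0" "time_periodic S h" "continuous_on UNIV h" "\<rho> \<ge> 0"
  obtains y s where "norm y \<le> \<rho>" "\<And>y' s'. norm y' \<le> \<rho> \<Longrightarrow> h (y', s') \<le> h (y, s)"
proof -
  let ?K = "cball (0 :: real^3) \<rho> \<times> {0..S}"
  have "compact ?K" "?K \<noteq> {}"
    using assms by (auto intro!: compact_Times)
  then obtain z where z: "z \<in> ?K" "\<And>z'. z' \<in> ?K \<Longrightarrow> h z' \<le> h z"
    using continuous_attains_sup[of ?K h] assms(3) continuous_on_subset by blast
  show ?thesis
  proof (rule that[of "fst z" "snd z"])
    fix y' :: "real^3" and s' assume "norm y' \<le> \<rho>"
    then have "h (y', s' - S * of_int \<lfloor>s' / S\<rfloor>) \<le> h z"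
      using mod_period_bounds[OF assms(1), of s'] by (intro z) auto
    then show "h (y', s') \<le> h (fst z, snd z)"
      by (simp add: time_periodic_reduce[OF assms(2)])
  qed (use z in auto)
qed

text \<open>Time is unconstrained at a maximum point \<open>(y, s)\<close> over the cylinder, so the time derivative
  vanishes there, whereas the derivative in a direction pointing out of the ball is nonnegative.\<close>

lemma periodic_maximum_principle:
  fixes h :: "spacetime \<Rightarrow> real"
  assumes "S > 0" "time_periodic S h" "continuous_on UNIV h"
    and sub: "\<And>y s. norm y \<le> \<rho> \<Longrightarrow> h (y, s) > 0 \<Longrightarrow> \<exists>w hs hy. (w = 0 \<or> w \<bullet> y > 0) \<and>
        ((\<lambda>t. h (y, t)) has_field_derivative hs) (at s) \<and>
        ((\<lambda>x. h (x, s)) has_derivative hy) (at y) \<and> c * hs + hy w < 0"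
    and y: "norm y \<le> \<rho>"
  shows "h (y, s) \<le> 0"
proof (rule ccontr)
  assume "\<not> h (y, s) \<le> 0"
  have "\<rho> \<ge> 0" using y norm_ge_zero order_trans by blast
  from periodic_attains_max[OF assms(1-3) this] obtain Y \<tau> where
    Y: "norm Y \<le> \<rho>" and max: "\<And>y' s'. norm y' \<le> \<rho> \<Longrightarrow> h (y', s') \<le> h (Y, \<tau>)"
    by metis
  have "h (Y, \<tau>) > 0"
    using max[OF y, of s] \<open>\<not> h (y, s) \<le> 0\<close> by linarith
  from sub[OF Y this] obtain w hs hy where w: "w = 0 \<or> w \<bullet> Y > 0"
    and hs: "((\<lambda>t. h (Y, t)) has_field_derivative hs) (at \<tau>)"
    and hy: "((\<lambda>x. h (x, \<tau>)) has_derivative hy) (at Y)" and neg: "c * hs + hy w < 0"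
    by blast
  have "hs = 0"
    by (rule DERIV_local_max[OF hs zero_less_one]) (use max[OF Y] in auto)
  have "hy w \<ge> 0"
    using w
  proof
    assume "w = 0"
    then show ?thesis
      using linear_0[OF has_derivative_linear[OF hy]] by simp
  next
    assume wY: "w \<bullet> Y > 0"
    have "((\<lambda>t. h (Y - t *\<^sub>R w, \<tau>)) has_derivative (\<lambda>t. hy (- (t *\<^sub>R w)))) (at 0)"
      by (rule has_derivative_compose[where g = "\<lambda>x. h (x, \<tau>)", unfolded o_def])
        (auto intro!: derivative_eq_intros hy)
    then have d: "((\<lambda>t. h (Y - t *\<^sub>R w, \<tau>)) has_field_derivative - hy w) (at 0)"
      unfolding has_field_derivative_def
      by (rule has_derivative_eq_rhs)
        (simp add: fun_eq_iff linear_neg[OF has_derivative_linear[OF hy]]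
          linear_scale[OF has_derivative_linear[OF hy]])
    show ?thesis
    proof (rule ccontr)
      assume "\<not> hy w \<ge> 0"
      with DERIV_pos_inc_right[OF d] obtain \<delta> where \<delta>: "\<delta> > 0"
        "\<And>t. 0 < t \<Longrightarrow> t < \<delta> \<Longrightarrow> h (Y, \<tau>) < h (Y - t *\<^sub>R w, \<tau>)"
        by auto
      have "w \<noteq> 0" using wY by auto
      \<comment> \<open>The first bound makes \<open>h\<close> increase strictly; the second makes
        the quadratic term in the square of \<open>norm (Y - t *\<^sub>R w)\<close> smaller than the
        linear one, so the point stays in the ball.\<close>
      define t where "t = min (\<delta> / 2) (w \<bullet> Y / (w \<bullet> w))"
      have t: "0 < t" "t < \<delta>" "t * (w \<bullet> w) \<le> w \<bullet> Y"
        using \<open>\<delta> > 0\<close> wY \<open>w \<noteq> 0\<close> by (auto simp: t_def min_def field_simps)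
      have "t * (t * (w \<bullet> w)) \<le> t * (2 * (w \<bullet> Y))"
        using t wY by (intro mult_left_mono) auto
      then have "(Y - t *\<^sub>R w) \<bullet> (Y - t *\<^sub>R w) \<le> Y \<bullet> Y"
        by (simp add: inner_diff_left inner_diff_right inner_commute algebra_simps)
      then have "norm (Y - t *\<^sub>R w) \<le> norm Y"
        by (simp add: norm_eq_sqrt_inner)
      then show False
        using max[of "Y - t *\<^sub>R w" \<tau>] Y \<delta>(2)[OF t(1,2)] by linarith
    qed
  qed
  then show False
    using neg \<open>hs = 0\<close> by simp
qed

text \<open>The weight \<open>exp (- \<mu> |y|\<^sup>2)\<close> decays along the drift \<open>\<sigma> b\<close>, which points out of the ball
  wherever \<open>g\<close> does not vanish; for large \<open>\<mu>\<close> this beats the zeroth order term.\<close>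

lemma transport_vanishing:
  fixes g :: "spacetime \<Rightarrow> real" and b :: "spacetime \<Rightarrow> real^3"
  assumes "S > 0" "time_periodic S g" "continuous_on UNIV g"
    and "\<bar>\<sigma>\<bar> = 1" "c > 0"
    and sub: "\<And>y s. norm y \<le> \<rho> \<Longrightarrow> g (y, s) > 0 \<Longrightarrow> \<sigma> * (b (y, s) \<bullet> y) \<ge> c \<and> (\<exists>gs gy.
        ((\<lambda>t. g (y, t)) has_field_derivative gs) (at s) \<and>
        ((\<lambda>x. g (x, s)) has_derivative gy) (at y) \<and> \<bar>gs + gy (b (y, s))\<bar> \<le> K * g (y, s))"
    and y: "norm y \<le> \<rho>"
  shows "g (y, s) \<le> 0"
proof -
  \<comment> \<open>Chosen so that \<open>2 * \<mu> * c = \<bar>K\<bar> + 1\<close>, which exceeds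
    \<open>K\<close>.\<close>
  define \<mu> where "\<mu> = (\<bar>K\<bar> + 1) / (2 * c)"
  define h where "h = (\<lambda>z. g z * exp (- \<mu> * (fst z \<bullet> fst z)))"
  \<comment> \<open>The maximum principle allows any coefficient in front of the time derivative.
    Taking \<sigma> there lets the whole transport equation be multiplied by \<sigma>, which
    reverses an inward drift.\<close>
  have "h (y, s) \<le> 0"
  proof (rule periodic_maximum_principle[OF assms(1) _ _ _ y, where c = \<sigma>])
    show "time_periodic S h"
      using assms(2) by (auto simp: time_periodic_def h_def)
    show "continuous_on UNIV h"
      unfolding h_def by (intro continuous_intros assms(3))
    fix y s assume "norm y \<le> \<rho>" "h (y, s) > 0"
    then have g: "g (y, s) > 0"
      by (simp add: h_def zero_less_mult_iff)
    from sub[OF \<open>norm y \<le> \<rho>\<close> this] obtain gs gy where b: "\<sigma> * (b (y, s) \<bullet> y) \<ge> c"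
      and gs: "((\<lambda>t. g (y, t)) has_field_derivative gs) (at s)"
      and gy: "((\<lambda>x. g (x, s)) has_derivative gy) (at y)"
      and bound: "\<bar>gs + gy (b (y, s))\<bar> \<le> K * g (y, s)"
      by blast
    let ?e = "exp (- \<mu> * (y \<bullet> y))" and ?w = "\<sigma> *\<^sub>R b (y, s)"
    let ?hy = "\<lambda>v. ?e * (gy v - 2 * \<mu> * (y \<bullet> v) * g (y, s))"
    have "((\<lambda>t. h (y, t)) has_field_derivative gs * ?e) (at s)"
      unfolding h_def fst_conv by (rule DERIV_cmult_right[OF gs])
    moreover have "((\<lambda>x. h (x, s)) has_derivative ?hy) (at y)"
      unfolding h_def fst_conv
      by (rule derivative_eq_intros gy refl)+ (auto simp: fun_eq_iff inner_commute algebra_simps)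
    moreover have "\<sigma> * (gs * ?e) + ?hy ?w < 0"
    proof -
      have "\<sigma> * (gs + gy (b (y, s))) \<le> K * g (y, s)"
        using bound \<open>\<bar>\<sigma>\<bar> = 1\<close> abs_le_iff[of "\<sigma> * (gs + gy (b (y, s)))" "K * g (y, s)"]
        by (simp add: abs_mult)
      moreover have "2 * \<mu> * (y \<bullet> ?w) \<ge> 2 * \<mu> * c"
        using b \<open>c > 0\<close> by (intro mult_left_mono) (auto simp: \<mu>_def inner_commute)
      then have "2 * \<mu> * (y \<bullet> ?w) * g (y, s) \<ge> (\<bar>K\<bar> + 1) * g (y, s)"
        using g \<open>c > 0\<close> by (intro mult_right_mono) (auto simp: \<mu>_def)
      moreover have "K * g (y, s) < (\<bar>K\<bar> + 1) * g (y, s)"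
        using g by (intro mult_strict_right_mono) auto
      ultimately have "\<sigma> * (gs + gy (b (y, s))) - 2 * \<mu> * (y \<bullet> ?w) * g (y, s) < 0"
        by linarith
      then have "?e * (\<sigma> * (gs + gy (b (y, s))) - 2 * \<mu> * (y \<bullet> ?w) * g (y, s)) < 0"
        by (simp add: mult_less_0_iff)
      then show ?thesis
        using linear_scale[OF has_derivative_linear[OF gy]] by (simp add: algebra_simps)
    qed
    moreover have "?w \<bullet> y > 0"
      using b \<open>c > 0\<close> by simp
    ultimately show "\<exists>w hs hy. (w = 0 \<or> w \<bullet> y > 0) \<and>
        ((\<lambda>t. h (y, t)) has_field_derivative hs) (at s) \<and>
        ((\<lambda>x. h (x, s)) has_derivative hy) (at y) \<and> \<sigma> * hs + hy w < 0"
      by blast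
  qed
  then show ?thesis
    by (simp add: h_def mult_le_0_iff)
qed

section \<open>Spatial and time derivatives of fields\<close>

text \<open>\<open>diff_y\<close> means Frechet differentiability in space, so the partial
  derivatives determine the whole derivative.\<close>

lemma has_derivative_dy:
  assumes "diff_y f"
  shows "((\<lambda>x. f (x, s)) has_derivative (\<lambda>h. \<Sum>j\<in>UNIV. h $ j *\<^sub>R dy j f (y, s))) (at y)"
proof -
  let ?D = "frechet_derivative (\<lambda>x. f (x, s)) (at y)"
  have D: "((\<lambda>x. f (x, s)) has_derivative ?D) (at y)"
    using assms by (simp add: diff_y_def frechet_derivative_works)
  have "?D h = (\<Sum>j\<in>UNIV. h $ j *\<^sub>R dy j f (y, s))" for h
  proof -
    have "?D h = ?D (\<Sum>j\<in>UNIV. h $ j *\<^sub>R axis j 1)"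
      using basis_expansion[of h] by (simp add: scalar_mult_eq_scaleR)
    also have "\<dots> = (\<Sum>j\<in>UNIV. h $ j *\<^sub>R ?D (axis j 1))"
      using has_derivative_linear[OF D] by (simp add: linear_sum linear_scale)
    finally show ?thesis by (simp add: dy_def)
  qed
  then have "?D = (\<lambda>h. \<Sum>j\<in>UNIV. h $ j *\<^sub>R dy j f (y, s))" by blast
  with D show ?thesis by simp
qed

lemma sum_axis_scaleR: "(\<Sum>k\<in>UNIV. axis j (1::real) $ k *\<^sub>R f k) = f j"
  for f :: "'n::finite \<Rightarrow> 'a::real_vector"
proof -
  have "axis j (1::real) $ k *\<^sub>R f k = (if k = j then f k else 0)" for k
    by (simp add: axis_def)
  then show ?thesis by simp
qed

lemma sum_axis_mult: "(\<Sum>k\<in>UNIV. axis j (1::real) $ k * f k) = f j"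
  for f :: "'n::finite \<Rightarrow> real"
  using sum_axis_scaleR[of j f] by simp

lemma has_vector_derivative_axis_line:
  assumes "diff_y f"
  shows "((\<lambda>r. f (y + r *\<^sub>R axis j 1, s)) has_vector_derivative dy j f (y + r *\<^sub>R axis j 1, s)) (at r)"
proof -
  have "((\<lambda>r. f (y + r *\<^sub>R axis j 1, s)) has_derivative
      (\<lambda>h. \<Sum>k\<in>UNIV. (h *\<^sub>R axis j 1) $ k *\<^sub>R dy k f (y + r *\<^sub>R axis j 1, s))) (at r)"
    by (rule has_derivative_compose[OF _ has_derivative_dy[OF assms], unfolded o_def])
      (auto intro!: derivative_eq_intros)
  then show ?thesis
    by (simp add: has_vector_derivative_def sum_axis_scaleR flip: scaleR_scaleR scaleR_sum_right)
qed

lemma has_vector_derivative_ds: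
  "diff_s f \<Longrightarrow> ((\<lambda>t. f (y, t)) has_vector_derivative ds f (y, s)) (at s)"
  by (simp add: diff_s_def ds_def vector_derivative_works)

lemma has_derivative_dy_nth:
  fixes f :: "spacetime \<Rightarrow> real^'n"
  assumes "diff_y f"
  shows "((\<lambda>x. f (x, s) $ i) has_derivative (\<lambda>h. \<Sum>j\<in>UNIV. h $ j * dy j f (y, s) $ i)) (at y)"
  using bounded_linear.has_derivative[OF bounded_linear_vec_nth[of i] has_derivative_dy[OF assms]]
  by (simp add: sum_component)

lemma has_field_derivative_vec_nth:
  "(f has_vector_derivative v) F \<Longrightarrow> ((\<lambda>t. f t $ i) has_field_derivative v $ i) F"
  using bounded_linear.has_vector_derivative[OF bounded_linear_vec_nth[of i]]
  by (simp add: has_real_derivative_iff_has_vector_derivative)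

lemma continuous_on_UNIV_compose:
  "continuous_on UNIV f \<Longrightarrow> continuous_on S p \<Longrightarrow> continuous_on S (\<lambda>x. f (p x))"
  by (rule continuous_on_compose2) auto

lemma Cy_2_iff: "Cy 2 f \<longleftrightarrow> continuous_on UNIV f \<and> diff_y f \<and> (\<forall>j. continuous_on UNIV (dy j f)
    \<and> diff_y (dy j f) \<and> (\<forall>k. continuous_on UNIV (dy k (dy j f))))"
  by (simp add: numeral_2_eq_2)

lemma dy_dy_commute:
  fixes f :: "spacetime \<Rightarrow> 'a::banach"
  assumes "Cy 2 f"
  shows "dy i (dy j f) z = dy j (dy i f) z"
proof -
  obtain y s where z: "z = (y, s)" by fastforce
  note f = assms[unfolded Cy_2_iff]
  have "(\<Sum>k\<in>UNIV. axis i (1::real) $ k *\<^sub>R dy k (dy j f) (y, s))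
      = (\<Sum>k\<in>UNIV. axis j (1::real) $ k *\<^sub>R dy k (dy i f) (y, s))"
  proof (rule symmetric_second_derivative[where f = "\<lambda>x. f (x, s)" and S = UNIV
        and f' = "\<lambda>y h. \<Sum>k\<in>UNIV. h $ k *\<^sub>R dy k f (y, s)"
        and Fh = "\<lambda>y h. \<Sum>k\<in>UNIV. h $ k *\<^sub>R dy k (dy j f) (y, s)"
        and Fk = "\<lambda>h. \<Sum>k\<in>UNIV. h $ k *\<^sub>R dy k (dy i f) (y, s)"])
    show "continuous_on UNIV (\<lambda>y. \<Sum>k\<in>UNIV. axis i (1::real) $ k *\<^sub>R dy k (dy j f) (y, s))"
      unfolding sum_axis_scaleR
      by (rule continuous_on_UNIV_compose) (use f in \<open>auto intro!: continuous_intros\<close>)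
  qed (use f in \<open>auto simp: sum_axis_scaleR intro!: has_derivative_dy\<close>)
  then show ?thesis
    by (simp only: sum_axis_scaleR z)
qed

text \<open>\<open>C1s_C2y\<close> speaks of spatial derivatives of \<open>ds f\<close> only.
  \<open>mixed_partials\<close> supplies the time derivative of \<open>dy j f\<close>, as needed to
  transport the vorticity.\<close>

lemma has_vector_derivative_ds_dy:
  fixes f :: "spacetime \<Rightarrow> 'a::banach"
  assumes "C1s_C2y f"
  shows "((\<lambda>t. dy j f (y, t)) has_vector_derivative dy j (ds f) (y, s)) (at s)"
proof -
  note f = assms[unfolded C1s_C2y_def Cy_2_iff]
  have "((\<lambda>t. dy j f (y + 0 *\<^sub>R axis j 1, t)) has_vector_derivative
      dy j (ds f) (y + 0 *\<^sub>R axis j 1, s)) (at s)"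
  proof (rule mixed_partials[where a = "-1" and b = 1 and c = "s - 1" and d = "s + 1"
        and r\<^sub>0 = 0 and t\<^sub>0 = s
        and \<phi> = "\<lambda>r t. f (y + r *\<^sub>R axis j 1, t)"
        and \<phi>r = "\<lambda>r t. dy j f (y + r *\<^sub>R axis j 1, t)"
        and \<phi>tr = "\<lambda>r t. dy j (ds f) (y + r *\<^sub>R axis j 1, t)"
        and \<phi>t = "\<lambda>r t. ds f (y + r *\<^sub>R axis j 1, t)"])
    show "continuous_on {s - 1<..<s + 1} (\<lambda>t. ds f (y + r *\<^sub>R axis j 1, t))" for r
      by (rule continuous_on_UNIV_compose) (use f in \<open>auto intro!: continuous_intros\<close>)
    show "continuous_on ({-1<..<1} \<times> {s - 1<..<s + 1}) (\<lambda>(r, t). dy j (ds f) (y + r *\<^sub>R axis j 1, t))"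
      unfolding split_beta
      by (rule continuous_on_UNIV_compose) (use f in \<open>auto intro!: continuous_intros\<close>)
  qed (use f in \<open>auto intro!: has_vector_derivative_ds has_vector_derivative_axis_line\<close>)
  then show ?thesis by simp
qed

lemma time_periodic_dy: "time_periodic S f \<Longrightarrow> time_periodic S (dy j f)"
  by (simp add: time_periodic_def dy_def)

lemma periodic_bounded:
  fixes f :: "spacetime \<Rightarrow> 'a::real_normed_vector"
  assumes "S > 0" "time_periodic S f" "continuous_on UNIV f"
  obtains M where "M \<ge> 0" "\<And>y s. norm y \<le> \<rho> \<Longrightarrow> norm (f (y, s)) \<le> M"
proof (cases "\<rho> \<ge> 0")
  case True
  have "time_periodic S (\<lambda>z. norm (f z))" "continuous_on UNIV (\<lambda>z. norm (f z))"
    using assms by (auto simp: time_periodic_def intro: continuous_intros)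
  from periodic_attains_max[OF assms(1) this True] that norm_ge_zero show ?thesis by metis
next
  case False
  then have "\<not> norm y \<le> \<rho>" for y :: "real^3"
    using norm_ge_zero[of y] by linarith
  then show ?thesis
    using that[of 0] by simp
qed

lemma sum_Basis_vec:
  "(\<Sum>b\<in>(Basis :: (real^'n) set). f b) = (\<Sum>i\<in>UNIV. f (axis i 1))"
proof -
  have *: "(Basis :: (real^'n) set) = range (\<lambda>i. axis i 1)"
    by (auto simp: Basis_vec_def)
  have "inj (\<lambda>i :: 'n. axis i (1::real))"
    by (auto simp: inj_on_def axis_eq_axis)
  then show ?thesis
    unfolding * by (simp add: sum.reindex o_def)
qed

lemma dy_eq_0:
  assumes "open U" "y \<in> U" "\<And>x. x \<in> U \<Longrightarrow> f (x, s) = 0"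
  shows "dy j f (y, s) = 0"
proof -
  have "((\<lambda>x. 0) has_derivative (\<lambda>h. 0)) (at y)"
    by simp
  then have "((\<lambda>x. f (x, s)) has_derivative (\<lambda>h. 0)) (at y)"
    by (rule has_derivative_transform_within_open[OF _ assms(1,2)]) (simp add: assms(3))
  then have "(\<lambda>h. 0) = frechet_derivative (\<lambda>x. f (x, s)) (at y)"
    by (rule frechet_derivative_at)
  from fun_cong[OF this, of "axis j 1"] show ?thesis
    by (simp add: dy_def)
qed

lemma has_derivative_vec_lambda:
  fixes f :: "'n::finite \<Rightarrow> 'a::real_normed_vector \<Rightarrow> real"
  assumes "\<And>k. (f k has_derivative f' k) (at x)"
  shows "((\<lambda>x. \<chi> k. f k x) has_derivative (\<lambda>h. \<chi> k. f' k h)) (at x)"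
  by (subst has_derivative_componentwise_within)
    (auto simp: Basis_vec_def inner_axis assms)

section \<open>Propagation of the zero set\<close>

locale periodic_MHD =
  fixes \<alpha> S :: real and V B :: "spacetime \<Rightarrow> real^3" and P :: "spacetime \<Rightarrow> real"
  assumes \<alpha>: "\<alpha> \<noteq> -1" and S: "S > 0"
    and V_C: "C1s_C2y V" and B_C: "C1 B"
    and solution: "self_similar_MHD \<alpha> V B P"
    and V_periodic: "time_periodic S V" and B_periodic: "time_periodic S B"
begin

abbreviation \<beta> :: real where "\<beta> \<equiv> 1 / (\<alpha> + 1)"

abbreviation \<kappa> :: real where "\<kappa> \<equiv> \<alpha> / (\<alpha> + 1)"

text \<open>The field \<open>b\<close> of the introductory text; it merges the scaling term with the
  convection by \<open>V\<close>.\<close>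

definition drift :: "spacetime \<Rightarrow> real^3" where
  "drift z = \<beta> *\<^sub>R fst z + V z"

lemma V_Cy: "Cy 2 V"
  using V_C by (auto simp: C1s_C2y_def)

lemma V_diff: "diff_y V" "diff_s V" "diff_y (dy j V)" "diff_y (ds V)"
  using V_C by (auto simp: C1s_C2y_def Cy_2_iff)

lemma V_cont: "continuous_on UNIV V" "continuous_on UNIV (ds V)" "continuous_on UNIV (dy j V)"
    "continuous_on UNIV (dy k (dy j V))" "continuous_on UNIV (dy j (ds V))"
  using V_C by (auto simp: C1s_C2y_def Cy_2_iff)

lemma B_diff: "diff_y B" "diff_s B" and P_diff: "diff_y P"
  using solution by (auto simp: self_similar_MHD_def)

lemma B_cont: "continuous_on UNIV B"
  using B_C unfolding C1_def
  by (meson continuous_at_imp_continuous_on has_derivative_continuous)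

lemma conv_drift: "\<beta> *\<^sub>R conv fst F z + conv V F z = (\<Sum>k\<in>UNIV. drift z $ k *\<^sub>R dy k F z)"
  by (simp add: conv_def drift_def scaleR_sum_right algebra_simps flip: sum.distrib)

lemma momentum_eq:
  "ds V z + \<kappa> *\<^sub>R V z + (\<Sum>k\<in>UNIV. drift z $ k *\<^sub>R dy k V z)
    = conv B B z - grad_y (\<lambda>w. P w + (1/2) * (norm (B w))\<^sup>2) z"
proof -
  have "ds V z + \<kappa> *\<^sub>R V z + \<beta> *\<^sub>R conv fst V z + conv V V z
      = conv B B z - grad_y (\<lambda>w. P w + (1/2) * (norm (B w))\<^sup>2) z"
    using solution unfolding self_similar_MHD_def by blast
  then show ?thesis
    by (simp only: add.assoc flip: conv_drift)
qed

lemma induction_eq: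
  "ds B z + \<kappa> *\<^sub>R B z + (\<Sum>k\<in>UNIV. drift z $ k *\<^sub>R dy k B z) = (\<Sum>k\<in>UNIV. B z $ k *\<^sub>R dy k V z)"
proof -
  have "ds B z + \<kappa> *\<^sub>R B z + \<beta> *\<^sub>R conv fst B z + conv V B z = conv B V z"
    using solution unfolding self_similar_MHD_def by blast
  then show ?thesis
    by (simp only: add.assoc conv_def[of B V] flip: conv_drift)
qed

lemma div_V: "(\<Sum>k\<in>UNIV. dy k V z $ k) = 0"
  using solution unfolding self_similar_MHD_def div_y_def by blast

section \<open>Transport of the magnetic field\<close>

lemma B_square_derivs:
  "((\<lambda>t. B (y, t) \<bullet> B (y, t)) has_field_derivative 2 * (ds B (y, s) \<bullet> B (y, s))) (at s)"
  "((\<lambda>x. B (x, s) \<bullet> B (x, s)) has_derivative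
     (\<lambda>h. 2 * ((\<Sum>k\<in>UNIV. h $ k *\<^sub>R dy k B (y, s)) \<bullet> B (y, s)))) (at y)"
proof -
  have "((\<lambda>t. B (y, t)) has_derivative (\<lambda>h. h *\<^sub>R ds B (y, s))) (at s)"
    using has_vector_derivative_ds[OF B_diff(2)] by (simp add: has_vector_derivative_def)
  from has_derivative_inner[OF this this]
  show "((\<lambda>t. B (y, t) \<bullet> B (y, t)) has_field_derivative 2 * (ds B (y, s) \<bullet> B (y, s))) (at s)"
    unfolding has_field_derivative_def
    by (rule has_derivative_eq_rhs) (simp add: fun_eq_iff inner_commute)
  from has_derivative_inner[OF has_derivative_dy[OF B_diff(1)] has_derivative_dy[OF B_diff(1)]]
  show "((\<lambda>x. B (x, s) \<bullet> B (x, s)) has_derivative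
     (\<lambda>h. 2 * ((\<Sum>k\<in>UNIV. h $ k *\<^sub>R dy k B (y, s)) \<bullet> B (y, s)))) (at y)"
    by (rule has_derivative_eq_rhs) (simp add: fun_eq_iff inner_commute)
qed

text \<open>The induction equation tested against \<open>2 *\<^sub>R B\<close>. The maximum
  principles concern scalars, so they are applied to the square of \<open>norm B\<close>.\<close>

lemma B_square_transport:
  "2 * (ds B z \<bullet> B z) + 2 * ((\<Sum>k\<in>UNIV. drift z $ k *\<^sub>R dy k B z) \<bullet> B z)
    = 2 * ((\<Sum>k\<in>UNIV. B z $ k *\<^sub>R dy k V z) \<bullet> B z) - 2 * \<kappa> * (B z \<bullet> B z)"
proof -
  have "ds B z + (\<Sum>k\<in>UNIV. drift z $ k *\<^sub>R dy k B z)
      = (\<Sum>k\<in>UNIV. B z $ k *\<^sub>R dy k V z) - \<kappa> *\<^sub>R B z"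
    using induction_eq[of z] by (simp add: algebra_simps)
  from arg_cong[OF this, of "\<lambda>v. 2 * (v \<bullet> B z)"] show ?thesis
    by (simp add: inner_add_left inner_diff_left algebra_simps)
qed

lemma B_square_periodic_cont:
  "time_periodic S (\<lambda>z. B z \<bullet> B z)" "continuous_on UNIV (\<lambda>z. B z \<bullet> B z)"
  using B_periodic by (auto simp: time_periodic_def intro!: continuous_intros B_cont)

lemma dy_V_bounded:
  obtains M where "M \<ge> 0" "\<And>y s j. norm y \<le> \<rho> \<Longrightarrow> norm (dy j V (y, s)) \<le> M"
proof -
  have "\<exists>M. M \<ge> 0 \<and> (\<forall>y s. norm y \<le> \<rho> \<longrightarrow> norm (dy j V (y, s)) \<le> M)" for j
    using periodic_bounded[OF S time_periodic_dy[OF V_periodic] V_cont(3), of \<rho> j] by metis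
  then obtain M where M: "\<And>j. M j \<ge> 0" "\<And>j y s. norm y \<le> \<rho> \<Longrightarrow> norm (dy j V (y, s)) \<le> M j"
    by metis
  show ?thesis
  proof (rule that[of "\<Sum>j\<in>UNIV. M j"])
    fix y :: "real^3" and s j assume "norm y \<le> \<rho>"
    then have "norm (dy j V (y, s)) \<le> M j" by (rule M)
    also have "\<dots> \<le> (\<Sum>j\<in>UNIV. M j)"
      by (rule member_le_sum) (use M in auto)
    finally show "norm (dy j V (y, s)) \<le> (\<Sum>j\<in>UNIV. M j)" .
  qed (use M in \<open>auto intro: sum_nonneg\<close>)
qed

text \<open>With \<open>V = 0\<close> the drift is \<open>\<beta> y\<close> and \<open>|B|\<^sup>2\<close> is damped at the rate \<open>2 \<kappa> > 0\<close>.\<close>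

lemma B_eq_0_of_V_eq_0:
  assumes "\<alpha> > 0" and V0: "\<And>y s. norm y < r \<Longrightarrow> V (y, s) = 0" and "\<rho> < r" and y: "norm y \<le> \<rho>"
  shows "B (y, s) = 0"
proof -
  have "B (y, s) \<bullet> B (y, s) \<le> 0"
  proof (rule periodic_maximum_principle[OF S B_square_periodic_cont _ y, where c = 1])
    fix y s assume "norm y \<le> \<rho>" and pos: "B (y, s) \<bullet> B (y, s) > 0"
    then have "norm y < r" using \<open>\<rho> < r\<close> by simp
    then have "drift (y, s) = \<beta> *\<^sub>R y" and "dy k V (y, s) = 0" for k
      using V0 by (auto simp: drift_def intro: dy_eq_0[of "ball 0 r"])
    with B_square_transport[of "(y, s)"] have "2 * (ds B (y, s) \<bullet> B (y, s))
        + 2 * ((\<Sum>k\<in>UNIV. (\<beta> *\<^sub>R y) $ k *\<^sub>R dy k B (y, s)) \<bullet> B (y, s)) = - 2 * \<kappa> * (B (y, s) \<bullet> B (y, s))"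
      by simp
    moreover have "2 * \<kappa> * (B (y, s) \<bullet> B (y, s)) > 0"
      using pos \<open>\<alpha> > 0\<close> by simp
    \<comment> \<open>The drift degenerates at the origin, which is why the maximum principle admits
      \<open>w = 0\<close>.\<close>
    moreover have "\<beta> *\<^sub>R y = 0 \<or> (\<beta> *\<^sub>R y) \<bullet> y > 0"
      using \<open>\<alpha> > 0\<close> by (cases "y = 0") auto
    ultimately show "\<exists>w hs hy. (w = 0 \<or> w \<bullet> y > 0) \<and>
        ((\<lambda>t. B (y, t) \<bullet> B (y, t)) has_field_derivative hs) (at s) \<and>
        ((\<lambda>x. B (x, s) \<bullet> B (x, s)) has_derivative hy) (at y) \<and> 1 * hs + hy w < 0"
      using B_square_derivs[where y = y and s = s] by (intro exI conjI) (assumption | simp)+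
  qed
  then show ?thesis
    by (metis inner_eq_zero_iff inner_ge_zero order_antisym)
qed

text \<open>The drift need not point outwards below radius \<open>R\<close>, but
  \<open>transport_vanishing\<close> asks for this only where \<open>B\<close> is nonzero. In its
  constant, \<open>6 * M\<close> is twice the bound for the three stretching terms, and
  \<open>2 * \<bar>\<kappa>\<bar>\<close> comes from the damping.\<close>

lemma B_eq_0_extends:
  assumes "\<bar>\<sigma>\<bar> = 1" "c > 0"
    and out: "\<And>y s. R \<le> norm y \<Longrightarrow> norm y \<le> \<rho> \<Longrightarrow> \<sigma> * (drift (y, s) \<bullet> y) \<ge> c"
    and zero: "\<And>y s. norm y < R \<Longrightarrow> B (y, s) = 0"
    and y: "norm y \<le> \<rho>"
  shows "B (y, s) = 0"
proof -
  obtain M where M: "M \<ge> 0" "\<And>y s j. norm y \<le> \<rho> \<Longrightarrow> norm (dy j V (y, s)) \<le> M"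
    using dy_V_bounded by blast
  have "B (y, s) \<bullet> B (y, s) \<le> 0"
  proof (rule transport_vanishing[OF S B_square_periodic_cont assms(1,2) _ y,
        where b = drift and K = "6 * M + 2 * \<bar>\<kappa>\<bar>"], intro conjI)
    fix y s assume y: "norm y \<le> \<rho>" and pos: "B (y, s) \<bullet> B (y, s) > 0"
    have "R \<le> norm y"
      using zero[of y s] pos by force
    then show "\<sigma> * (drift (y, s) \<bullet> y) \<ge> c"
      using out y by simp
    let ?B = "B (y, s)"
    have "norm (\<Sum>k\<in>UNIV. ?B $ k *\<^sub>R dy k V (y, s)) \<le> (\<Sum>k\<in>(UNIV :: 3 set). norm ?B * M)"
      using component_le_norm_cart[of ?B] M(2)[OF y]
      by (intro sum_norm_le) (auto intro!: mult_mono)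
    then have "norm (\<Sum>k\<in>UNIV. ?B $ k *\<^sub>R dy k V (y, s)) * norm ?B \<le> 3 * (norm ?B * M) * norm ?B"
      by (intro mult_right_mono) auto
    moreover have "\<bar>(\<Sum>k\<in>UNIV. ?B $ k *\<^sub>R dy k V (y, s)) \<bullet> ?B\<bar>
        \<le> norm (\<Sum>k\<in>UNIV. ?B $ k *\<^sub>R dy k V (y, s)) * norm ?B"
      by (rule Cauchy_Schwarz_ineq2)
    ultimately have 1: "\<bar>(\<Sum>k\<in>UNIV. ?B $ k *\<^sub>R dy k V (y, s)) \<bullet> ?B\<bar> \<le> 3 * M * (?B \<bullet> ?B)"
      by (simp add: dot_square_norm power2_eq_square algebra_simps)
    have 2: "\<bar>\<kappa> * (?B \<bullet> ?B)\<bar> = \<bar>\<kappa>\<bar> * (?B \<bullet> ?B)"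
      by (simp add: abs_mult)
    have "\<bar>2 * (ds B (y, s) \<bullet> ?B) + 2 * ((\<Sum>k\<in>UNIV. drift (y, s) $ k *\<^sub>R dy k B (y, s)) \<bullet> ?B)\<bar>
        \<le> (6 * M + 2 * \<bar>\<kappa>\<bar>) * (?B \<bullet> ?B)"
      using 1 2 unfolding B_square_transport distrib_right by linarith
    then show "\<exists>gs gy. ((\<lambda>t. B (y, t) \<bullet> B (y, t)) has_field_derivative gs) (at s) \<and>
        ((\<lambda>x. B (x, s) \<bullet> B (x, s)) has_derivative gy) (at y) \<and>
        \<bar>gs + gy (drift (y, s))\<bar> \<le> (6 * M + 2 * \<bar>\<kappa>\<bar>) * (?B \<bullet> ?B)"
      using B_square_derivs[where y = y and s = s] by blast
  qed
  then show ?thesis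
    by (metis inner_eq_zero_iff inner_ge_zero order_antisym)
qed

section \<open>The vorticity equation\<close>

definition F :: "3 \<Rightarrow> spacetime \<Rightarrow> real" where
  "F j z = - (ds V z $ j + \<kappa> * V z $ j + (\<Sum>k\<in>UNIV. drift z $ k * dy k V z $ j))"

text \<open>The derivative of \<open>F j\<close> in direction \<open>i\<close>. As \<open>F\<close>
  is built from \<open>V\<close> alone, it is differentiable in space; where it is the gradient of
  the total pressure, this yields the second derivatives of a pressure assumed merely
  differentiable.\<close>

definition dF :: "3 \<Rightarrow> 3 \<Rightarrow> spacetime \<Rightarrow> real" where
  "dF i j z = - (dy i (ds V) z $ j + \<kappa> * dy i V z $ j + \<beta> * dy i V z $ j
     + (\<Sum>k\<in>UNIV. dy i V z $ k * dy k V z $ j) + (\<Sum>k\<in>UNIV. drift z $ k * dy i (dy k V) z $ j))"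

lemma drift_cont: "continuous_on UNIV drift"
  unfolding drift_def by (intro continuous_intros V_cont)

lemma F_deriv: "((\<lambda>x. F j (x, s)) has_derivative (\<lambda>h. \<Sum>i\<in>UNIV. h $ i * dF i j (y, s))) (at y)"
proof -
  have nth: "((\<lambda>x. x $ k) has_derivative (\<lambda>h. h $ k)) (at y)" for k :: 3 and y :: "real^3"
    by (rule bounded_linear_imp_has_derivative[OF bounded_linear_vec_nth])
  have "((\<lambda>x. - (ds V (x, s) $ j + \<kappa> * V (x, s) $ j
        + (\<Sum>k\<in>UNIV. (\<beta> * x $ k + V (x, s) $ k) * dy k V (x, s) $ j))) has_derivative
      (\<lambda>h. - ((\<Sum>i\<in>UNIV. h $ i * dy i (ds V) (y, s) $ j) + \<kappa> * (\<Sum>i\<in>UNIV. h $ i * dy i V (y, s) $ j)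
        + (\<Sum>k\<in>UNIV. (\<beta> * y $ k + V (y, s) $ k) * (\<Sum>i\<in>UNIV. h $ i * dy i (dy k V) (y, s) $ j)
          + (\<beta> * h $ k + (\<Sum>i\<in>UNIV. h $ i * dy i V (y, s) $ k)) * dy k V (y, s) $ j)))) (at y)"
    by (intro has_derivative_minus has_derivative_add has_derivative_sum has_derivative_mult
        has_derivative_mult_right nth has_derivative_dy_nth V_diff)
  then have "((\<lambda>x. F j (x, s)) has_derivative
      (\<lambda>h. - ((\<Sum>i\<in>UNIV. h $ i * dy i (ds V) (y, s) $ j) + \<kappa> * (\<Sum>i\<in>UNIV. h $ i * dy i V (y, s) $ j)
        + (\<Sum>k\<in>UNIV. (\<beta> * y $ k + V (y, s) $ k) * (\<Sum>i\<in>UNIV. h $ i * dy i (dy k V) (y, s) $ j)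
          + (\<beta> * h $ k + (\<Sum>i\<in>UNIV. h $ i * dy i V (y, s) $ k)) * dy k V (y, s) $ j)))) (at y)"
    by (simp add: F_def drift_def)
  then show ?thesis
    by (rule has_derivative_eq_rhs)
      (simp add: fun_eq_iff dF_def drift_def sum_3 algebra_simps del: times_divide_eq_left times_divide_eq_right)
qed

lemma dF_cont: "continuous_on UNIV (dF i j)"
  unfolding dF_def by (intro continuous_intros V_cont drift_cont)

text \<open>Where \<open>B = 0\<close>, the field \<open>F\<close> is the gradient of the total pressure, so its curl vanishes.\<close>

lemma dF_symmetric:
  assumes zero: "\<And>x. norm x < \<rho> \<Longrightarrow> B (x, s) = 0" and y: "norm y < \<rho>"
  shows "dF i j (y, s) = dF j i (y, s)"
proof -
  define Q where "Q = (\<lambda>w. P w + (1/2) * (norm (B w))\<^sup>2)"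
  have "(\<lambda>x. B (x, s) \<bullet> B (x, s)) differentiable (at y)" for y s
    using B_square_derivs(2) by (auto simp: differentiable_def)
  then have Q_diff: "diff_y Q"
    using P_diff by (auto simp: diff_y_def Q_def power2_norm_eq_inner intro!: derivative_intros)
  have grad: "dy k Q (x, s) = F k (x, s)" if "norm x < \<rho>" for k x
  proof -
    have "conv B B (x, s) = 0"
      using zero[OF that] by (simp add: conv_def)
    then have "grad_y Q (x, s) = - (ds V (x, s) + \<kappa> *\<^sub>R V (x, s)
        + (\<Sum>k\<in>UNIV. drift (x, s) $ k *\<^sub>R dy k V (x, s)))"
      using momentum_eq[of "(x, s)"] by (simp add: Q_def)
    from arg_cong[OF this, of "\<lambda>v. v $ k"] show ?thesis
      by (simp add: grad_y_def F_def sum_component)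
  qed
  have "(\<Sum>k\<in>UNIV. axis i (1::real) $ k * dF k j (y, s)) = (\<Sum>k\<in>UNIV. axis j (1::real) $ k * dF k i (y, s))"
  proof (rule symmetric_second_derivative[where f = "\<lambda>x. Q (x, s)" and S = "ball 0 \<rho>"
        and f' = "\<lambda>x h. \<Sum>k\<in>UNIV. h $ k * F k (x, s)"
        and Fh = "\<lambda>x h. \<Sum>k\<in>UNIV. h $ k * dF k j (x, s)"
        and Fk = "\<lambda>h. \<Sum>k\<in>UNIV. h $ k * dF k i (y, s)"])
    show "((\<lambda>x. Q (x, s)) has_derivative (\<lambda>h. \<Sum>k\<in>UNIV. h $ k * F k (x, s))) (at x)"
      if "x \<in> ball 0 \<rho>" for x
      using has_derivative_dy[OF Q_diff, of s x] grad that by simp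
    show "continuous_on (ball 0 \<rho>) (\<lambda>x. \<Sum>k\<in>UNIV. axis i (1::real) $ k * dF k j (x, s))"
      unfolding sum_axis_mult
      by (rule continuous_on_UNIV_compose[OF dF_cont]) (intro continuous_intros)
  qed (use y in \<open>auto simp: sum_axis_mult intro: F_deriv\<close>)
  then show ?thesis
    by (simp only: sum_axis_mult)
qed

text \<open>The curl as an antisymmetric matrix, which keeps the stretching term a matrix
  product.\<close>

definition \<Omega> :: "3 \<Rightarrow> 3 \<Rightarrow> spacetime \<Rightarrow> real" where
  "\<Omega> i j z = dy i V z $ j - dy j V z $ i"

lemma \<Omega>_deriv_s:
  "((\<lambda>t. \<Omega> i j (y, t)) has_field_derivative dy i (ds V) (y, s) $ j - dy j (ds V) (y, s) $ i) (at s)"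
  unfolding \<Omega>_def
  by (intro DERIV_diff has_field_derivative_vec_nth has_vector_derivative_ds_dy V_C)

lemma \<Omega>_deriv_y:
  "((\<lambda>x. \<Omega> i j (x, s)) has_derivative
     (\<lambda>h. (\<Sum>k\<in>UNIV. h $ k * (dy k (dy i V) (y, s) $ j - dy k (dy j V) (y, s) $ i)))) (at y)"
  unfolding \<Omega>_def right_diff_distrib sum_subtractf
  by (intro has_derivative_diff has_derivative_dy_nth V_diff)

text \<open>With \<open>A\<^sub>i\<^sub>j = \<partial>\<^sub>i V\<^sub>j\<close> and \<open>\<Omega> = A - A\<^sup>T\<close>, the stretching term \<open>A\<^sup>2 - (A\<^sup>T)\<^sup>2\<close> equals \<open>A \<Omega> + \<Omega> A\<^sup>T\<close>, so it is
  linear in \<open>\<Omega>\<close>.\<close>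

lemma vorticity_eq:
  assumes "dF i j z = dF j i z"
  shows "(dy i (ds V) z $ j - dy j (ds V) z $ i)
      + (\<Sum>k\<in>UNIV. drift z $ k * (dy k (dy i V) z $ j - dy k (dy j V) z $ i))
    = - ((\<kappa> + \<beta>) * \<Omega> i j z + (\<Sum>k\<in>UNIV. dy i V z $ k * \<Omega> k j z + dy j V z $ k * \<Omega> i k z))"
proof -
  have "dF i j z - dF j i z = 0" using assms by simp
  then show ?thesis
    \<comment> \<open>Commuting the derivatives turns the drift terms into derivatives of \<Omega>
      along the drift.\<close>
    unfolding dF_def dy_dy_commute[OF V_Cy, of i] dy_dy_commute[OF V_Cy, of j]
    by (simp add: \<Omega>_def sum_3 algebra_simps del: times_divide_eq_left times_divide_eq_right)
qed

definition enstrophy :: "spacetime \<Rightarrow> real" where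
  "enstrophy z = (\<Sum>i\<in>UNIV. \<Sum>j\<in>UNIV. (\<Omega> i j z)\<^sup>2)"

lemma \<Omega>_square_le: "(\<Omega> i j z)\<^sup>2 \<le> enstrophy z"
proof -
  have "(\<Omega> i j z)\<^sup>2 \<le> (\<Sum>j\<in>UNIV. (\<Omega> i j z)\<^sup>2)"
    by (rule member_le_sum) auto
  also have "\<dots> \<le> enstrophy z"
    unfolding enstrophy_def
    by (rule member_le_sum[of i UNIV "\<lambda>i. \<Sum>j\<in>UNIV. (\<Omega> i j z)\<^sup>2"]) (auto intro: sum_nonneg)
  finally show ?thesis .
qed

lemma \<Omega>_product_le: "\<bar>\<Omega> i j z * \<Omega> k l z\<bar> \<le> enstrophy z"
proof -
  have "2 * \<bar>\<Omega> i j z\<bar> * \<bar>\<Omega> k l z\<bar> \<le> \<bar>\<Omega> i j z\<bar>\<^sup>2 + \<bar>\<Omega> k l z\<bar>\<^sup>2"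
    by (rule sum_squares_bound)
  then show ?thesis
    using \<Omega>_square_le[of i j z] \<Omega>_square_le[of k l z] by (simp add: abs_mult)
qed

text \<open>The scheme of \<open>B_eq_0_extends\<close>, applied to the enstrophy. \<open>B\<close>
  has to vanish on a larger open ball so that the vorticity equation holds at every point of the
  closed ball of radius \<rho>.\<close>

lemma \<Omega>_eq_0_extends:
  assumes "\<bar>\<sigma>\<bar> = 1" "c > 0"
    and out: "\<And>y s. R \<le> norm y \<Longrightarrow> norm y \<le> \<rho> \<Longrightarrow> \<sigma> * (drift (y, s) \<bullet> y) \<ge> c"
    and zero: "\<And>y s. norm y < R \<Longrightarrow> V (y, s) = 0"
    and B0: "\<And>y s. norm y < \<rho>' \<Longrightarrow> B (y, s) = 0" and "\<rho> < \<rho>'"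
    and y: "norm y \<le> \<rho>"
  shows "\<Omega> i j (y, s) = 0"
proof -
  obtain M where M: "M \<ge> 0" "\<And>y s j. norm y \<le> \<rho> \<Longrightarrow> norm (dy j V (y, s)) \<le> M"
    using dy_V_bounded by blast
  \<comment> \<open>Nine index pairs times the factor 2 from the square give 18; three values of
    \<open>k\<close> with two stretching products each give \<open>6 * M\<close>.\<close>
  define K where "K = 18 * (\<bar>\<kappa> + \<beta>\<bar> + 6 * M)"
  have "enstrophy (y, s) \<le> 0"
  proof (rule transport_vanishing[OF S _ _ assms(1,2) _ y, where b = drift and K = K], goal_cases)
    case 1
    have "time_periodic S (dy i V)" for i
      by (rule time_periodic_dy[OF V_periodic])
    then show ?case
      by (simp add: time_periodic_def enstrophy_def \<Omega>_def)
  next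
    case 2
    show ?case
      unfolding enstrophy_def \<Omega>_def by (intro continuous_intros V_cont)
  next
    case (3 y s)
    let ?z = "(y, s)"
    have "R \<le> norm y"
    proof (rule ccontr)
      assume "\<not> R \<le> norm y"
      then have "dy i V ?z = 0" for i
        using zero by (intro dy_eq_0[of "ball 0 R"]) auto
      then show False
        using 3(2) by (simp add: enstrophy_def \<Omega>_def)
    qed
    then have out': "\<sigma> * (drift ?z \<bullet> y) \<ge> c"
      using out 3(1) by simp
    let ?gs = "\<Sum>i\<in>UNIV. \<Sum>j\<in>UNIV. 2 * \<Omega> i j ?z * (dy i (ds V) ?z $ j - dy j (ds V) ?z $ i)"
    let ?gy = "\<lambda>h. \<Sum>i\<in>UNIV. \<Sum>j\<in>UNIV. 2 * \<Omega> i j ?z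
        * (\<Sum>k\<in>UNIV. h $ k * (dy k (dy i V) ?z $ j - dy k (dy j V) ?z $ i))"
    have gs: "((\<lambda>t. enstrophy (y, t)) has_field_derivative ?gs) (at s)"
      unfolding enstrophy_def
      by (intro DERIV_sum) (auto intro!: derivative_eq_intros \<Omega>_deriv_s)
    have gy: "((\<lambda>x. enstrophy (x, s)) has_derivative ?gy) (at y)"
    proof -
      have "((\<lambda>x. \<Sum>i\<in>UNIV. \<Sum>j\<in>UNIV. \<Omega> i j (x, s) * \<Omega> i j (x, s)) has_derivative
        (\<lambda>h. \<Sum>i\<in>UNIV. \<Sum>j\<in>UNIV. \<Omega> i j ?z
            * (\<Sum>k\<in>UNIV. h $ k * (dy k (dy i V) ?z $ j - dy k (dy j V) ?z $ i))
          + (\<Sum>k\<in>UNIV. h $ k * (dy k (dy i V) ?z $ j - dy k (dy j V) ?z $ i)) * \<Omega> i j ?z)) (at y)"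
        by (intro has_derivative_sum has_derivative_mult \<Omega>_deriv_y)
      then show ?thesis
        by (simp add: enstrophy_def power2_eq_square algebra_simps flip: mult_2)
    qed
    have E: "\<bar>2 * \<Omega> i j ?z * ((dy i (ds V) ?z $ j - dy j (ds V) ?z $ i)
      + (\<Sum>k\<in>UNIV. drift ?z $ k * (dy k (dy i V) ?z $ j - dy k (dy j V) ?z $ i)))\<bar>
      \<le> 2 * (\<bar>\<kappa> + \<beta>\<bar> + 6 * M) * enstrophy ?z" (is "\<bar>2 * _ * ?L\<bar> \<le> _") for i j
    proof -
      have A: "\<bar>dy i V ?z $ k\<bar> \<le> M" for i k
        using component_le_norm_cart[of "dy i V ?z" k] M(2)[OF 3(1), of i s] by linarith
      have L: "?L = - ((\<kappa> + \<beta>) * \<Omega> i j ?z + (\<Sum>k\<in>UNIV. dy i V ?z $ k * \<Omega> k j ?z + dy j V ?z $ k * \<Omega> i k ?z))"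
        using 3(1) B0 \<open>\<rho> < \<rho>'\<close> by (intro vorticity_eq dF_symmetric[of \<rho>']) auto
      have "\<Omega> i j ?z * ?L = - ((\<kappa> + \<beta>) * (\<Omega> i j ?z * \<Omega> i j ?z)
          + (\<Sum>k\<in>UNIV. dy i V ?z $ k * (\<Omega> i j ?z * \<Omega> k j ?z) + dy j V ?z $ k * (\<Omega> i j ?z * \<Omega> i k ?z)))"
        unfolding L by (simp add: sum_distrib_left algebra_simps del: times_divide_eq_left times_divide_eq_right)
      then have "\<bar>\<Omega> i j ?z * ?L\<bar> \<le> \<bar>(\<kappa> + \<beta>) * (\<Omega> i j ?z * \<Omega> i j ?z)\<bar>
          + \<bar>\<Sum>k\<in>UNIV. dy i V ?z $ k * (\<Omega> i j ?z * \<Omega> k j ?z) + dy j V ?z $ k * (\<Omega> i j ?z * \<Omega> i k ?z)\<bar>"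
        by linarith
      also have "\<bar>(\<kappa> + \<beta>) * (\<Omega> i j ?z * \<Omega> i j ?z)\<bar> \<le> \<bar>\<kappa> + \<beta>\<bar> * enstrophy ?z"
        unfolding abs_mult[of "\<kappa> + \<beta>"] by (intro mult_left_mono \<Omega>_product_le) auto
      also have "\<bar>\<Sum>k\<in>UNIV. dy i V ?z $ k * (\<Omega> i j ?z * \<Omega> k j ?z) + dy j V ?z $ k * (\<Omega> i j ?z * \<Omega> i k ?z)\<bar>
          \<le> (\<Sum>k\<in>(UNIV :: 3 set). M * enstrophy ?z + M * enstrophy ?z)"
      proof (rule order_trans[OF sum_abs sum_mono])
        fix k
        have "\<bar>dy i V ?z $ k * (\<Omega> i j ?z * \<Omega> k j ?z)\<bar> \<le> M * enstrophy ?z"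
          unfolding abs_mult[of "dy i V ?z $ k"] by (intro mult_mono A \<Omega>_product_le M) auto
        moreover have "\<bar>dy j V ?z $ k * (\<Omega> i j ?z * \<Omega> i k ?z)\<bar> \<le> M * enstrophy ?z"
          unfolding abs_mult[of "dy j V ?z $ k"] by (intro mult_mono A \<Omega>_product_le M) auto
        ultimately show "\<bar>dy i V ?z $ k * (\<Omega> i j ?z * \<Omega> k j ?z) + dy j V ?z $ k * (\<Omega> i j ?z * \<Omega> i k ?z)\<bar>
            \<le> M * enstrophy ?z + M * enstrophy ?z"
          by linarith
      qed
      finally have "\<bar>\<Omega> i j ?z * ?L\<bar> \<le> (\<bar>\<kappa> + \<beta>\<bar> + 6 * M) * enstrophy ?z"
        by (simp add: algebra_simps del: times_divide_eq_left times_divide_eq_right)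
      then have "2 * \<bar>\<Omega> i j ?z * ?L\<bar> \<le> 2 * ((\<bar>\<kappa> + \<beta>\<bar> + 6 * M) * enstrophy ?z)"
        by (rule mult_left_mono) simp
      then show ?thesis
        by (simp only: abs_mult mult.assoc abs_numeral)
    qed
    have "\<bar>?gs + ?gy (drift ?z)\<bar> = \<bar>\<Sum>i\<in>UNIV. \<Sum>j\<in>UNIV. 2 * \<Omega> i j ?z
      * ((dy i (ds V) ?z $ j - dy j (ds V) ?z $ i)
      + (\<Sum>k\<in>UNIV. drift ?z $ k * (dy k (dy i V) ?z $ j - dy k (dy j V) ?z $ i)))\<bar>"
      by (simp only: distrib_left sum.distrib)
    also have "\<dots> \<le> (\<Sum>i\<in>(UNIV :: 3 set). \<Sum>j\<in>(UNIV :: 3 set). 2 * (\<bar>\<kappa> + \<beta>\<bar> + 6 * M) * enstrophy ?z)"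
      by (intro order_trans[OF sum_abs sum_mono] E)
    also have "\<dots> = K * enstrophy ?z"
    proof -
      have "(\<Sum>i\<in>(UNIV :: 3 set). \<Sum>j\<in>(UNIV :: 3 set). 2 * q * e) = 18 * q * e" for q e :: real
        unfolding sum_3 by linarith
      then show ?thesis unfolding K_def .
    qed
    finally have bound: "\<bar>?gs + ?gy (drift ?z)\<bar> \<le> K * enstrophy ?z" .
    show ?case
      by (rule conjI[OF out'], rule exI, rule exI, rule conjI[OF gs conjI[OF gy bound]])
  qed
  then have "(\<Omega> i j (y, s))\<^sup>2 \<le> 0"
    using \<Omega>_square_le order_trans by blast
  then show ?thesis by simp
qed

text \<open>A field that is both curl free and divergence free is harmonic.\<close>

lemma V_eq_0_of_\<Omega>_eq_0:
  assumes curl: "\<And>x i j. norm x < \<rho> \<Longrightarrow> \<Omega> i j (x, s) = 0"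
    and "R > 0" and zero: "\<And>x. norm x < R \<Longrightarrow> V (x, s) = 0" and y: "norm y < \<rho>"
  shows "V (y, s) = 0"
proof -
  have "V (y, s) $ i = 0" for i
  proof -
    interpret harmonic_on_ball "\<lambda>x. V (x, s) $ i" "\<lambda>x. \<chi> k. dy k V (x, s) $ i"
      "\<lambda>x h. \<chi> k. \<Sum>l\<in>UNIV. h $ l * dy l (dy k V) (x, s) $ i" \<rho>
    proof
      fix x h k :: "real^3"
      show "((\<lambda>x. V (x, s) $ i) has_derivative (\<bullet>) (\<chi> k. dy k V (x, s) $ i)) (at x)"
        using has_derivative_dy_nth[OF V_diff(1), of s i x]
        by (rule has_derivative_eq_rhs) (simp add: fun_eq_iff inner_vec_def mult.commute)
      show "((\<lambda>x. \<chi> k. dy k V (x, s) $ i) has_derivative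
          (\<lambda>h. \<chi> k. \<Sum>l\<in>UNIV. h $ l * dy l (dy k V) (x, s) $ i)) (at x)"
        by (intro has_derivative_vec_lambda has_derivative_dy_nth V_diff)
      show "continuous_on UNIV (\<lambda>x. \<chi> k. \<Sum>l\<in>UNIV. h $ l * dy l (dy k V) (x, s) $ i)"
        by (intro continuous_intros continuous_on_UNIV_compose[OF V_cont(4)])
      have "(\<Sum>k\<in>UNIV. \<Sum>l\<in>UNIV. h $ l * dy l (dy k V) (x, s) $ i * v $ k)
          = (\<Sum>l\<in>UNIV. \<Sum>k\<in>UNIV. v $ k * dy k (dy l V) (x, s) $ i * h $ l)" for v
        by (subst sum.swap, intro sum.cong refl) (simp add: dy_dy_commute[OF V_Cy] mult_ac)
      then show "(\<chi> k. \<Sum>l\<in>UNIV. h $ l * dy l (dy k V) (x, s) $ i) \<bullet> k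
          = (\<chi> k'. \<Sum>l\<in>UNIV. k $ l * dy l (dy k' V) (x, s) $ i) \<bullet> h"
        by (simp add: inner_vec_def sum_distrib_right)
      assume x: "norm x < \<rho>"
      \<comment> \<open>Differentiating the vanishing curl. Summed over \<open>k\<close>, the right
        side is the \<open>i\<close>-th derivative of the divergence, hence zero.\<close>
      have diag: "dy k (dy k V) (x, s) $ i = dy i (dy k V) (x, s) $ k" for k
      proof -
        have "((\<lambda>x. \<Omega> k i (x, s)) has_derivative (\<lambda>h. 0)) (at x)"
          by (rule has_derivative_transform_within_open[OF has_derivative_const[of 0] open_ball[of 0 \<rho>]])
            (use x curl in auto)
        from has_derivative_unique[OF this \<Omega>_deriv_y]
        have "(\<Sum>l\<in>UNIV. axis k 1 $ l * (dy l (dy k V) (x, s) $ i - dy l (dy i V) (x, s) $ k)) = 0"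
          by metis
        then show ?thesis
          by (simp add: sum_axis_mult dy_dy_commute[OF V_Cy, of k i])
      qed
      have "((\<lambda>x. \<Sum>k\<in>UNIV. dy k V (x, s) $ k) has_derivative
          (\<lambda>h. \<Sum>k\<in>UNIV. \<Sum>l\<in>UNIV. h $ l * dy l (dy k V) (x, s) $ k)) (at x)"
        by (intro has_derivative_sum has_derivative_dy_nth V_diff)
      then have "((\<lambda>x. 0) has_derivative
          (\<lambda>h. \<Sum>k\<in>UNIV. \<Sum>l\<in>UNIV. h $ l * dy l (dy k V) (x, s) $ k)) (at x)"
        by (simp only: div_V)
      from has_derivative_unique[OF has_derivative_const this]
      have "(\<Sum>k\<in>UNIV. \<Sum>l\<in>UNIV. axis i 1 $ l * dy l (dy k V) (x, s) $ k) = 0"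
        by metis
      then have "(\<Sum>k\<in>UNIV. dy k (dy k V) (x, s) $ i) = 0"
        by (simp add: sum_axis_mult diag)
      then show "(\<Sum>b\<in>Basis. (\<chi> k. \<Sum>l\<in>UNIV. b $ l * dy l (dy k V) (x, s) $ i) \<bullet> b) = 0"
        by (simp add: sum_Basis_vec inner_axis sum_axis_mult)
    qed
    show ?thesis
      by (rule unique_continuation[OF \<open>R > 0\<close> _ y]) (simp add: zero)
  qed
  then show ?thesis
    by (simp add: vec_eq_iff)
qed

text \<open>\<open>V\<close> vanishes on the sphere of radius \<open>R\<close>, so uniform
  continuity on a compact cylinder and periodicity give
  \<open>norm (V (y, s)) \<le> \<bar>\<beta>\<bar> * R / 2\<close> on a thin shell at all times, at
  most half of the scaling part. The factor \<open>sgn \<beta>\<close> handles \<alpha> <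
  -1.\<close>

lemma drift_outward:
  assumes "R > 0" and zero: "\<And>y s. norm y \<le> R \<Longrightarrow> V (y, s) = 0"
  obtains \<epsilon> where "\<epsilon> > 0" "\<And>y s. R \<le> norm y \<Longrightarrow> norm y \<le> R + \<epsilon> \<Longrightarrow>
    sgn \<beta> * (drift (y, s) \<bullet> y) \<ge> \<bar>\<beta>\<bar> * R\<^sup>2 / 2"
proof -
  have \<beta>: "\<bar>\<beta>\<bar> > 0" using \<alpha> by auto
  let ?K = "cball (0 :: real^3) (R + 1) \<times> {0..S}"
  have "uniformly_continuous_on ?K V"
    by (intro compact_uniformly_continuous continuous_on_subset[OF V_cont(1)] compact_Times) auto
  then obtain \<delta> where \<delta>: "\<delta> > 0"
    "\<And>z z'. z \<in> ?K \<Longrightarrow> z' \<in> ?K \<Longrightarrow> dist z' z < \<delta> \<Longrightarrow> dist (V z') (V z) < \<bar>\<beta>\<bar> * R / 2"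
    unfolding uniformly_continuous_on_def using \<beta> \<open>R > 0\<close> by (metis half_gt_zero mult_pos_pos)
  define \<epsilon> where "\<epsilon> = min 1 (\<delta> / 2)"
  have \<epsilon>: "0 < \<epsilon>" "\<epsilon> \<le> 1" "\<epsilon> < \<delta>"
    using \<open>\<delta> > 0\<close> by (auto simp: \<epsilon>_def)
  show ?thesis
  proof (rule that[OF \<epsilon>(1)])
    fix y :: "real^3" and s assume y: "R \<le> norm y" "norm y \<le> R + \<epsilon>"
    define s' where "s' = s - S * of_int \<lfloor>s / S\<rfloor>"
    have s': "s' \<in> {0..S}"
      using mod_period_bounds[OF S, of s] by (simp add: s'_def)
    have Vs: "V (x, s') = V (x, s)" for x
      unfolding s'_def by (rule time_periodic_reduce[OF V_periodic])
    \<comment> \<open>The radial projection of \<open>y\<close> to the sphere where \<open>V\<close>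
      is known to vanish.\<close>
    define y' where "y' = (R / norm y) *\<^sub>R y"
    have "norm y > 0" using y \<open>R > 0\<close> by linarith
    then have y': "norm y' = R"
      using \<open>R > 0\<close> by (simp add: y'_def)
    have "y - y' = (1 - R / norm y) *\<^sub>R y"
      by (simp add: y'_def algebra_simps)
    then have "norm (y - y') = \<bar>1 - R / norm y\<bar> * norm y"
      by simp
    also have "\<dots> = norm y - R"
      using y \<open>norm y > 0\<close> by (simp add: abs_if field_simps)
    finally have "dist (y, s') (y', s') < \<delta>"
      using y \<epsilon> by (simp add: dist_Pair_Pair dist_norm)
    moreover have "(y', s') \<in> ?K" "(y, s') \<in> ?K"
      using s' y' y \<epsilon> by auto
    ultimately have "dist (V (y, s')) (V (y', s')) < \<bar>\<beta>\<bar> * R / 2"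
      using \<delta>(2) by blast
    then have "norm (V (y, s)) \<le> \<bar>\<beta>\<bar> * R / 2"
      using zero[of y' s'] y' by (simp add: Vs)
    then have "norm (V (y, s)) * norm y \<le> \<bar>\<beta>\<bar> * R / 2 * norm y"
      by (rule mult_right_mono) simp
    moreover have "\<bar>sgn \<beta> * (V (y, s) \<bullet> y)\<bar> \<le> norm (V (y, s)) * norm y"
      using Cauchy_Schwarz_ineq2[of "V (y, s)" y] \<beta> by (simp add: abs_mult abs_sgn_eq)
    ultimately have "sgn \<beta> * (V (y, s) \<bullet> y) \<ge> - (\<bar>\<beta>\<bar> * R / 2 * norm y)"
      by linarith
    moreover have "sgn \<beta> * (drift (y, s) \<bullet> y) = \<bar>\<beta>\<bar> * (norm y * norm y) + sgn \<beta> * (V (y, s) \<bullet> y)"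
    proof -
      have "sgn \<beta> * (drift (y, s) \<bullet> y) = (sgn \<beta> * \<beta>) * (y \<bullet> y) + sgn \<beta> * (V (y, s) \<bullet> y)"
        by (simp only: drift_def fst_conv inner_add_left inner_scaleR_left distrib_left mult.assoc)
      then show ?thesis
        by (simp only: sgn_mult_self_eq abs_sgn mult.commute[of "sgn \<beta>" \<beta>] dot_square_norm power2_eq_square)
    qed
    moreover have "\<bar>\<beta>\<bar> * (norm y * norm y) - \<bar>\<beta>\<bar> * R / 2 * norm y \<ge> \<bar>\<beta>\<bar> * R\<^sup>2 / 2"
    proof -
      have "R * (R / 2) \<le> norm y * (norm y - R / 2)"
        using y \<open>R > 0\<close> by (intro mult_mono) auto
      then have "\<bar>\<beta>\<bar> * (R * (R / 2)) \<le> \<bar>\<beta>\<bar> * (norm y * (norm y - R / 2))"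
        by (rule mult_left_mono) simp
      then show ?thesis
        by (simp only: power2_eq_square right_diff_distrib) (simp add: mult_ac)
    qed
    ultimately show "sgn \<beta> * (drift (y, s) \<bullet> y) \<ge> \<bar>\<beta>\<bar> * R\<^sup>2 / 2"
      by linarith
  qed
qed

text \<open>The radius shrinks along the chain: \<open>B\<close> vanishes up to
  \<open>R + \<epsilon>\<close>, \<Omega> up to \<open>R + \<epsilon> / 2\<close>, \<open>V\<close>
  strictly below \<open>R + \<epsilon> / 2\<close>, and \<open>R + \<epsilon> / 3\<close> serves for
  a closed ball.\<close>

lemma vanishing_extends:
  assumes "R > 0" and zero: "\<And>y s. norm y \<le> R \<Longrightarrow> V (y, s) = 0 \<and> B (y, s) = 0"
  obtains R' where "R' > R" "\<And>y s. norm y \<le> R' \<Longrightarrow> V (y, s) = 0 \<and> B (y, s) = 0"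
proof -
  obtain \<epsilon> where \<epsilon>: "\<epsilon> > 0" and out: "\<And>y s. R \<le> norm y \<Longrightarrow> norm y \<le> R + \<epsilon> \<Longrightarrow>
      sgn \<beta> * (drift (y, s) \<bullet> y) \<ge> \<bar>\<beta>\<bar> * R\<^sup>2 / 2"
    using drift_outward[OF \<open>R > 0\<close>] zero by metis
  have \<sigma>: "\<bar>sgn \<beta>\<bar> = 1" and c: "\<bar>\<beta>\<bar> * R\<^sup>2 / 2 > 0"
    using \<alpha> \<open>R > 0\<close> by (auto simp: abs_sgn_eq)
  have B0: "B (y, s) = 0" if "norm y \<le> R + \<epsilon>" for y s
    by (rule B_eq_0_extends[OF \<sigma> c out _ that]) (use zero in auto)
  have \<Omega>0: "\<Omega> i j (y, s) = 0" if "norm y \<le> R + \<epsilon> / 2" for i j y s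
    by (rule \<Omega>_eq_0_extends[OF \<sigma> c out _ B0 _ that, where \<rho>' = "R + \<epsilon>"]) (use zero \<epsilon> in auto)
  have V0: "V (y, s) = 0" if "norm y < R + \<epsilon> / 2" for y s
    by (rule V_eq_0_of_\<Omega>_eq_0[OF \<Omega>0 \<open>R > 0\<close> _ that]) (use zero in auto)
  show ?thesis
    by (rule that[of "R + \<epsilon> / 3"]) (use \<epsilon> B0 V0 in auto)
qed

text \<open>If the admissible radii were bounded, continuity would make their supremum admissible,
  and \<open>vanishing_extends\<close> would then exceed it.\<close>

lemma vanishing:
  assumes "r > 0" and zero: "\<And>y s. norm y < r \<Longrightarrow> V (y, s) = 0 \<and> B (y, s) = 0"
  shows "V (y, s) = 0 \<and> B (y, s) = 0"
proof -
  define T where "T = {R. \<forall>y s. norm y \<le> R \<longrightarrow> V (y, s) = 0 \<and> B (y, s) = 0}"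
  have r: "r / 2 \<in> T"
    using zero \<open>r > 0\<close> by (auto simp: T_def)
  have down: "R' \<in> T" if "R \<in> T" "R' \<le> R" for R R'
    using that by (force simp: T_def)
  have "\<not> bdd_above T"
  proof
    assume bdd: "bdd_above T"
    define R where "R = Sup T"
    have "R \<ge> r / 2"
      unfolding R_def by (rule cSup_upper[OF r bdd])
    then have "R > 0" using \<open>r > 0\<close> by linarith
    have inside: "V (y, s) = 0 \<and> B (y, s) = 0" if "y \<in> ball 0 R" for y s
    proof -
      have "\<exists>R'\<in>T. norm y < R'"
        using that r bdd unfolding R_def by (subst (asm) mem_ball_0, subst (asm) less_cSup_iff) auto
      then show ?thesis by (auto simp: T_def)
    qed
    have closed: "closed {y. f (y, s) = 0}" if "continuous_on UNIV f" for f :: "spacetime \<Rightarrow> real^3" and s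
      by (rule closed_Collect_eq)
        (intro continuous_on_const continuous_on_UNIV_compose[OF that] continuous_intros)+
    have "V (y, s) = 0 \<and> B (y, s) = 0" if "norm y \<le> R" for y s
    proof -
      have "closure (ball 0 R) \<subseteq> {y. V (y, s) = 0} \<inter> {y. B (y, s) = 0}"
        by (rule closure_minimal) (use inside closed V_cont(1) B_cont in auto)
      then have "cball 0 R \<subseteq> {y. V (y, s) = 0} \<inter> {y. B (y, s) = 0}"
        using \<open>R > 0\<close> by simp
      then show ?thesis
        using that by auto
    qed
    from vanishing_extends[OF \<open>R > 0\<close> this] obtain R' where "R' > R"
      "\<And>y s. norm y \<le> R' \<Longrightarrow> V (y, s) = 0 \<and> B (y, s) = 0"
      by blast
    then have "R' \<in> T" by (simp add: T_def)
    with \<open>R' > R\<close> show False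
      using cSup_upper[OF _ bdd, of R'] by (simp add: R_def)
  qed
  then obtain R where "R \<in> T" "norm y \<le> R"
    unfolding bdd_above_def by (meson linear)
  then show ?thesis by (simp add: T_def)
qed

end

section \<open>From one open period to all times, and the conclusion\<close>

lemma periodic_eq_0:
  fixes f :: "spacetime \<Rightarrow> real^3"
  assumes "S > 0" "time_periodic S f" "continuous_on UNIV f" and zero: "\<And>s. s \<in> {0<..<S} \<Longrightarrow> f (y, s) = 0"
  shows "f (y, s) = 0"
proof -
  have "closed {s. f (y, s) = 0}"
    by (rule closed_Collect_eq)
      (intro continuous_on_const continuous_on_UNIV_compose[OF assms(3)] continuous_intros)+
  \<comment> \<open>The hypothesis leaves out the endpoints of the period; continuity recovers them
    before periodicity is used.\<close>
  then have "closure {0<..<S} \<subseteq> {s. f (y, s) = 0}"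
    using zero by (intro closure_minimal) auto
  moreover have "s - S * of_int \<lfloor>s / S\<rfloor> \<in> closure {0<..<S}"
    using mod_period_bounds[OF \<open>S > 0\<close>, of s] \<open>S > 0\<close> by (simp add: closure_greaterThanLessThan)
  ultimately have "f (y, s - S * of_int \<lfloor>s / S\<rfloor>) = 0"
    by blast
  then show ?thesis
    by (simp add: time_periodic_reduce[OF assms(2)])
qed

theorem theorem1p3:
  fixes \<alpha> S\<^sub>0 :: real and V B :: "spacetime \<Rightarrow> real^3"
  assumes "\<alpha> \<noteq> -1"
    and "S\<^sub>0 > 0"
    and "C1s_C2y V"
    and "C1 B"
    and "time_periodic_solution \<alpha> S\<^sub>0 V B"
    and "\<alpha> > 0 \<Longrightarrow>
      \<exists>G. open G \<and> 0 \<in> G \<and> (\<forall>y\<in>G. \<forall>s\<in>{0<..<S\<^sub>0}. V (y, s) = 0)"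
    and "(-1 < \<alpha> \<and> \<alpha> \<le> 0) \<or> \<alpha> < -1 \<Longrightarrow>
      \<exists>G. open G \<and> 0 \<in> G \<and> (\<forall>y\<in>G. \<forall>s\<in>{0<..<S\<^sub>0}. V (y, s) = 0 \<and> B (y, s) = 0)"
  shows "\<forall>y s. V (y, s) = 0 \<and> B (y, s) = 0"
proof -
  from assms(5) obtain P
    where P: "self_similar_MHD \<alpha> V B P" "time_periodic S\<^sub>0 V" "time_periodic S\<^sub>0 B"
    by (auto simp: time_periodic_solution_def)
  interpret periodic_MHD \<alpha> S\<^sub>0 V B P
    by (intro periodic_MHD.intro assms(1-4) P)
  have V0: "V (y, s) = 0" if "\<And>s. s \<in> {0<..<S\<^sub>0} \<Longrightarrow> V (y, s) = 0" for y s
    using periodic_eq_0[OF S V_periodic V_cont(1)] that by blast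
  have B0: "B (y, s) = 0" if "\<And>s. s \<in> {0<..<S\<^sub>0} \<Longrightarrow> B (y, s) = 0" for y s
    using periodic_eq_0[OF S B_periodic B_cont] that by blast
  \<comment> \<open>Both cases lead to one ball on which \<open>V\<close> and \<open>B\<close>
    vanish at all times, the starting point of the continuation in the radius.\<close>
  have "\<exists>r>0. \<forall>y s. norm y < r \<longrightarrow> V (y, s) = 0 \<and> B (y, s) = 0"
  proof (cases "\<alpha> > 0")
    case True
    with assms(6) obtain G where "open G" "0 \<in> G" and G: "\<And>y s. y \<in> G \<Longrightarrow> s \<in> {0<..<S\<^sub>0} \<Longrightarrow> V (y, s) = 0"
      by blast
    then obtain r where r: "r > 0" "ball 0 r \<subseteq> G"
      using openE by blast
    have *: "V (y, s) = 0" if "norm y < r" for y s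
    proof (rule V0)
      have "y \<in> G" using r(2) that by auto
      then show "V (y, s) = 0" if "s \<in> {0<..<S\<^sub>0}" for s
        by (rule G[OF _ that])
    qed
    \<comment> \<open>The damping argument for \<open>B\<close> works on closed balls strictly
      inside the region where \<open>V\<close> vanishes, hence the smaller radius.\<close>
    have "B (y, s) = 0" if "norm y \<le> r / 2" for y s
      by (rule B_eq_0_of_V_eq_0[OF True *  _ that]) (use r in auto)
    with * r(1) show ?thesis
      by (intro exI[of _ "r / 2"]) auto
  next
    case False
    moreover have "\<alpha> < -1 \<or> -1 < \<alpha>"
      using assms(1) by (simp only: neq_iff)
    ultimately have "(-1 < \<alpha> \<and> \<alpha> \<le> 0) \<or> \<alpha> < -1"
      by linarith
    with assms(7) obtain G where "open G" "0 \<in> G"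
      and G: "\<And>y s. y \<in> G \<Longrightarrow> s \<in> {0<..<S\<^sub>0} \<Longrightarrow> V (y, s) = 0 \<and> B (y, s) = 0"
      by blast
    then obtain r where r: "r > 0" "ball 0 r \<subseteq> G"
      using openE by blast
    have "V (y, s) = 0 \<and> B (y, s) = 0" if "norm y < r" for y s
    proof -
      have "y \<in> G" using r(2) that by auto
      then show ?thesis
        using G by (blast intro: V0 B0)
    qed
    with r(1) show ?thesis by blast
  qed
  then show ?thesis
    using vanishing by blast
qed

end
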